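(* Let $\mathcal C$ be a small finitary Abelian category which is hereditary and cofinitary, let $\mathbf S=\{S_i : i\in I\}$ be a set of pairwise non-isomorphic simple objects of $\mathcal C$ having no self-extensions, and let $\mathbf i=(i_1,\ldots,i_m)\in I^m$. Let $\Psi_{\mathcal C,\mathbf i}:\mathcal H^*(\mathcal C)\to P_{\mathbf i}$ be the algebra homomorphism $[V]^*\mapsto X_{V,\mathbf i}$, and let $U_+^*$ be the subalgebra of $\mathcal H^*(\mathcal C)$ generated by the $[S_i]^*$, $i\in I$. Then the restriction of $\Psi_{\mathcal C,\mathbf i}$ to $U_+^*$ is the homomorphism $\Psi_{\mathbf i}:U_+^*\to P_{\mathbf i}$ determined by $$\Psi_{\mathbf i}([S_j]^* )=\sum_{k:\ i_k=j}t_k\qquad (j\in I).$$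
   Context: Finitary: all $\mathrm{Ext}^i(U,V)$, $i\ge 0$ (with $\mathrm{Ext}^0=\mathrm{Hom}$), are finite sets. Hereditary: $\mathrm{Ext}^i=0$ for $i\ge 2$. Cofinitary: every object $V$ admits only finitely many pairs of isomorphism classes $([U],[W])$ such that $V$ has a subobject isomorphic to $W$ with quotient isomorphic to $U$. $\langle V,W\rangle=\prod_{i\ge 0}|\mathrm{Ext}^i(V,W)|^{\frac12(-1)^i}$ (positive root); it depends only on the classes $|V|,|W|$ in the Grothendieck group $\mathcal K(\mathcal C)$. $\Bbbk$ is a field of characteristic $0$ containing all $\langle V,W\rangle^{1/2}$ (positive roots). $\mathcal H^*(\mathcal C)$ is the dual Hall-Ringel algebra: the $\Bbbk$-vector space with basis $\delta_{[V]}$ labelled by isomorphism classes of objects, with product $$\delta_{[U]}\delta_{[W]}=\sum_{[V]}\langle U,W\rangle\,|\mathcal F^V_{U,W}|\,\frac{|\mathrm{Aut}(U)||\mathrm{Aut}(W)|}{|\mathrm{Aut}(V)|}\,\delta_{[V]},\qquad \mathcal F^V_{U,W}=\{R\subset V: R\cong W,\ V/R\cong U\}.$$ $[V]^*:=\langle V,V\rangle^{-1/2}f(|V|)\,\delta_{[V]}$, where $f:\mathcal K(\mathcal C)\to\Bbbk^\times$ is the group homomorphism with $f(|S|)=\langle S,S\rangle^{1/2}$ for every simple $S$. $P_{\mathbf i}$ is the $\Bbbk$-algebra generated by $t_1,\ldots,t_m$ subject to $t_\ell t_k=\langle S_{i_k},S_{i_\ell}\rangle\langle S_{i_\ell},S_{i_k}\rangle\,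 t_kt_\ell$ for $k<\ell$. For an object $V$, $$X_{V,\mathbf i}=\sum_{\mathbf a\in\mathbb Z_{\ge0}^m}\ \prod_{1\le k<\ell\le m}\Big(\frac{\langle S_{i_k},S_{i_\ell}\rangle}{\langle S_{i_\ell},S_{i_k}\rangle}\Big)^{\frac12a_ka_\ell}\,|\mathcal F_{\mathbf i,\mathbf a}(V)|\,t_1^{a_1}\cdots t_m^{a_m},$$ where $\mathcal F_{\mathbf i,\mathbf a}(V)$ is the set of flags of subobjects $0=V_m\subset V_{m-1}\subset\cdots\subset V_0=V$ with $V_{k-1}/V_k\cong S_{i_k}^{\oplus a_k}$ for $k=1,\ldots,m$. *)

theory Defs
  imports "HOL-Algebra.Algebra" "HOL-Algebra.Algebraic_Closure_Type" "HOL-Library.Groups_Big_Fun"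
begin

section \<open>Abelian categories\<close>

text \<open>A small category enriched with the data of an addition on parallel arrows; both the objects
  and the arrows form sets.  \<open>g \<diamond> f\<close> is \<open>g\<close> after \<open>f\<close>.\<close>

record ('o, 'm) precat =
  Obj :: "'o set"
  Arr :: "'m set"
  Src :: "'m \<Rightarrow> 'o"
  Tgt :: "'m \<Rightarrow> 'o"
  Idn :: "'o \<Rightarrow> 'm"
  Cmp :: "'m \<Rightarrow> 'm \<Rightarrow> 'm"  (infixr "\<diamond>\<index>" 75)
  Pls :: "'m \<Rightarrow> 'm \<Rightarrow> 'm"
  Zro :: "'o \<Rightarrow> 'o \<Rightarrow> 'm"

definition Hom :: "('o, 'm, 'z) precat_scheme \<Rightarrow> 'o \<Rightarrow> 'o \<Rightarrow> 'm set" where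
  "Hom C A B = {f \<in> Arr C. Src C f = A \<and> Tgt C f = B}"

definition hom_group :: "('o, 'm, 'z) precat_scheme \<Rightarrow> 'o \<Rightarrow> 'o \<Rightarrow> 'm monoid" where
  "hom_group C A B = \<lparr>carrier = Hom C A B, monoid.mult = Pls C, one = Zro C A B\<rparr>"

locale category =
  fixes C :: "('o, 'm, 'z) precat_scheme" (structure)
  assumes src_obj: "f \<in> Arr C \<Longrightarrow> Src C f \<in> Obj C"
    and tgt_obj: "f \<in> Arr C \<Longrightarrow> Tgt C f \<in> Obj C"
    and idn_hom: "A \<in> Obj C \<Longrightarrow> Idn C A \<in> Hom C A A"
    and cmp_hom: "f \<in> Hom C A B \<Longrightarrow> g \<in> Hom C B D \<Longrightarrow> g \<diamond> f \<in> Hom C A D"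
    and cmp_assoc: "f \<in> Hom C A B \<Longrightarrow> g \<in> Hom C B D \<Longrightarrow> h \<in> Hom C D E \<Longrightarrow>
      (h \<diamond> g) \<diamond> f = h \<diamond> (g \<diamond> f)"
    and cmp_idn: "f \<in> Hom C A B \<Longrightarrow> f \<diamond> Idn C A = f"
    and idn_cmp: "f \<in> Hom C A B \<Longrightarrow> Idn C B \<diamond> f = f"

locale preadditive_category = category +
  assumes hom_group: "A \<in> Obj C \<Longrightarrow> B \<in> Obj C \<Longrightarrow> comm_group (hom_group C A B)"
    and cmp_pls_left: "f \<in> Hom C A B \<Longrightarrow> g \<in> Hom C B D \<Longrightarrow> h \<in> Hom C B D \<Longrightarrow>
      Pls C g h \<diamond> f = Pls C (g \<diamond> f) (h \<diamond> f)"
    and cmp_pls_right: "f \<in> Hom C A B \<Longrightarrow> g \<in> Hom C A B \<Longrightarrow> h \<in> Hom C B D \<Longrightarrow>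
      h \<diamond> Pls C f g = Pls C (h \<diamond> f) (h \<diamond> g)"

definition is_mono :: "('o, 'm, 'z) precat_scheme \<Rightarrow> 'm \<Rightarrow> bool" where
  "is_mono C f \<longleftrightarrow> f \<in> Arr C \<and>
    (\<forall>A. \<forall>g\<in>Hom C A (Src C f). \<forall>h\<in>Hom C A (Src C f). f \<diamond>\<^bsub>C\<^esub> g = f \<diamond>\<^bsub>C\<^esub> h \<longrightarrow> g = h)"

definition is_epi :: "('o, 'm, 'z) precat_scheme \<Rightarrow> 'm \<Rightarrow> bool" where
  "is_epi C f \<longleftrightarrow> f \<in> Arr C \<and>
    (\<forall>A. \<forall>g\<in>Hom C (Tgt C f) A. \<forall>h\<in>Hom C (Tgt C f) A. g \<diamond>\<^bsub>C\<^esub> f = h \<diamond>\<^bsub>C\<^esub> f \<longrightarrow> g = h)"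

definition is_iso :: "('o, 'm, 'z) precat_scheme \<Rightarrow> 'm \<Rightarrow> bool" where
  "is_iso C f \<longleftrightarrow> f \<in> Arr C \<and>
    (\<exists>g\<in>Hom C (Tgt C f) (Src C f). g \<diamond>\<^bsub>C\<^esub> f = Idn C (Src C f) \<and> f \<diamond>\<^bsub>C\<^esub> g = Idn C (Tgt C f))"

definition isomorphic :: "('o, 'm, 'z) precat_scheme \<Rightarrow> 'o \<Rightarrow> 'o \<Rightarrow> bool" where
  "isomorphic C A B \<longleftrightarrow> (\<exists>f\<in>Hom C A B. is_iso C f)"

definition Aut :: "('o, 'm, 'z) precat_scheme \<Rightarrow> 'o \<Rightarrow> 'm set" where
  "Aut C A = {f \<in> Hom C A A. is_iso C f}"

definition is_zero_obj :: "('o, 'm, 'z) precat_scheme \<Rightarrow> 'o \<Rightarrow> bool" where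
  "is_zero_obj C Z \<longleftrightarrow> Z \<in> Obj C \<and>
    (\<forall>A\<in>Obj C. (\<exists>!f. f \<in> Hom C Z A) \<and> (\<exists>!f. f \<in> Hom C A Z))"

definition is_kernel :: "('o, 'm, 'z) precat_scheme \<Rightarrow> 'm \<Rightarrow> 'm \<Rightarrow> bool" where
  "is_kernel C k f \<longleftrightarrow> k \<in> Arr C \<and> f \<in> Arr C \<and> Tgt C k = Src C f \<and>
    f \<diamond>\<^bsub>C\<^esub> k = Zro C (Src C k) (Tgt C f) \<and>
    (\<forall>A. \<forall>g\<in>Hom C A (Src C f). f \<diamond>\<^bsub>C\<^esub> g = Zro C A (Tgt C f) \<longrightarrow>
      (\<exists>!h. h \<in> Hom C A (Src C k) \<and> k \<diamond>\<^bsub>C\<^esub> h = g))"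

definition is_cokernel :: "('o, 'm, 'z) precat_scheme \<Rightarrow> 'm \<Rightarrow> 'm \<Rightarrow> bool" where
  "is_cokernel C c f \<longleftrightarrow> c \<in> Arr C \<and> f \<in> Arr C \<and> Src C c = Tgt C f \<and>
    c \<diamond>\<^bsub>C\<^esub> f = Zro C (Src C f) (Tgt C c) \<and>
    (\<forall>A. \<forall>g\<in>Hom C (Tgt C f) A. g \<diamond>\<^bsub>C\<^esub> f = Zro C (Src C f) A \<longrightarrow>
      (\<exists>!h. h \<in> Hom C (Tgt C c) A \<and> h \<diamond>\<^bsub>C\<^esub> c = g))"

text \<open>\<open>D\<close> is the direct sum (biproduct) of \<open>A 0, \<dots>, A (n - 1)\<close> with the given injections and
  projections; for \<open>n = 0\<close> this says that \<open>D\<close> is a zero object.\<close>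

definition is_direct_sum ::
  "('o, 'm, 'z) precat_scheme \<Rightarrow> nat \<Rightarrow> (nat \<Rightarrow> 'o) \<Rightarrow> 'o \<Rightarrow> (nat \<Rightarrow> 'm) \<Rightarrow> (nat \<Rightarrow> 'm) \<Rightarrow> bool" where
  "is_direct_sum C n A D inc prj \<longleftrightarrow> D \<in> Obj C \<and>
    (\<forall>j<n. inc j \<in> Hom C (A j) D \<and> prj j \<in> Hom C D (A j)) \<and>
    (\<forall>j<n. \<forall>l<n. prj l \<diamond>\<^bsub>C\<^esub> inc j = (if j = l then Idn C (A j) else Zro C (A j) (A l))) \<and>
    finprod (hom_group C D D) (\<lambda>j. inc j \<diamond>\<^bsub>C\<^esub> prj j) {..<n} = Idn C D"

locale abelian_category = preadditive_category +
  assumes zero_obj: "\<exists>Z. is_zero_obj C Z"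
    and direct_sums: "(\<And>j. j < n \<Longrightarrow> A j \<in> Obj C) \<Longrightarrow> \<exists>D inc prj. is_direct_sum C n A D inc prj"
    and kernels: "f \<in> Arr C \<Longrightarrow> \<exists>k. is_kernel C k f"
    and cokernels: "f \<in> Arr C \<Longrightarrow> \<exists>c. is_cokernel C c f"
    and normal_mono: "is_mono C f \<Longrightarrow> \<exists>g. is_kernel C f g"
    and normal_epi: "is_epi C f \<Longrightarrow> \<exists>g. is_cokernel C f g"

definition isoclass :: "('o, 'm, 'z) precat_scheme \<Rightarrow> 'o \<Rightarrow> 'o set" where
  "isoclass C A = {B \<in> Obj C. isomorphic C A B}"

definition Isoclasses :: "('o, 'm, 'z) precat_scheme \<Rightarrow> 'o set set" where
  "Isoclasses C = isoclass C ` Obj C"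

definition is_simple :: "('o, 'm, 'z) precat_scheme \<Rightarrow> 'o \<Rightarrow> bool" where
  "is_simple C A \<longleftrightarrow> A \<in> Obj C \<and> \<not> is_zero_obj C A \<and>
    (\<forall>k. is_mono C k \<and> Tgt C k = A \<longrightarrow> is_zero_obj C (Src C k) \<or> is_iso C k)"

definition is_power :: "('o, 'm, 'z) precat_scheme \<Rightarrow> nat \<Rightarrow> 'o \<Rightarrow> 'o \<Rightarrow> bool" where
  "is_power C n A D \<longleftrightarrow> (\<exists>inc prj. is_direct_sum C n (\<lambda>_. A) D inc prj)"

section \<open>Yoneda Ext\<close>

text \<open>Exactness of \<open>f\<close> followed by \<open>g\<close>: the image of \<open>f\<close> is the kernel of \<open>g\<close>.\<close>

definition exact_at :: "('o, 'm, 'z) precat_scheme \<Rightarrow> 'm \<Rightarrow> 'm \<Rightarrow> bool" where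
  "exact_at C f g \<longleftrightarrow> (\<exists>k e. is_kernel C k g \<and> is_epi C e \<and> Tgt C e = Src C k \<and> f = k \<diamond>\<^bsub>C\<^esub> e)"

text \<open>For \<open>n > 0\<close>: the exact sequences
  \<open>0 \<rightarrow> V \<rightarrow> E\<^sub>1 \<rightarrow> \<dots> \<rightarrow> E\<^sub>n \<rightarrow> U \<rightarrow> 0\<close>, as the list of their \<open>n + 1\<close> inner arrows.\<close>

definition extensions :: "('o, 'm, 'z) precat_scheme \<Rightarrow> nat \<Rightarrow> 'o \<Rightarrow> 'o \<Rightarrow> 'm list set" where
  "extensions C n U V = {fs. length fs = Suc n \<and> set fs \<subseteq> Arr C \<and>
    Src C (hd fs) = V \<and> Tgt C (last fs) = U \<and> is_mono C (hd fs) \<and> is_epi C (last fs) \<and>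
    (\<forall>j<n. exact_at C (fs ! j) (fs ! Suc j))}"

text \<open>Pairs of extensions linked by a morphism of complexes that is the identity on both ends.\<close>

definition ext_step ::
  "('o, 'm, 'z) precat_scheme \<Rightarrow> nat \<Rightarrow> 'o \<Rightarrow> 'o \<Rightarrow> ('m list \<times> 'm list) set" where
  "ext_step C n U V = {(fs, gs). fs \<in> extensions C n U V \<and> gs \<in> extensions C n U V \<and>
    (\<exists>h. h 0 = Idn C V \<and> h (Suc n) = Idn C U \<and>
      (\<forall>j\<le>n. h j \<in> Hom C (Src C (fs ! j)) (Src C (gs ! j)) \<and>
        gs ! j \<diamond>\<^bsub>C\<^esub> h j = h (Suc j) \<diamond>\<^bsub>C\<^esub> fs ! j))}"

text \<open>The underlying set of \<open>Ext\<^sup>n(U, V)\<close>.  Its group structure is never used, only its cardinality.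
  A morphism \<open>f\<close>, as an element of \<open>Ext\<^sup>0 = Hom\<close>, is represented by \<open>{[f]}\<close> so that all degrees
  have the same type.\<close>

definition Ext :: "('o, 'm, 'z) precat_scheme \<Rightarrow> nat \<Rightarrow> 'o \<Rightarrow> 'o \<Rightarrow> 'm list set set" where
  "Ext C n U V = (if n = 0 then (\<lambda>f. {[f]}) ` Hom C U V
     else extensions C n U V // (ext_step C n U V \<union> (ext_step C n U V)\<inverse>)\<^sup>*)"

text \<open>A group is zero iff its underlying set is a singleton.\<close>

definition Ext_vanishes :: "('o, 'm, 'z) precat_scheme \<Rightarrow> nat \<Rightarrow> 'o \<Rightarrow> 'o \<Rightarrow> bool" where
  "Ext_vanishes C n U V \<longleftrightarrow> (\<exists>e. Ext C n U V = {e})"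

definition finitary :: "('o, 'm, 'z) precat_scheme \<Rightarrow> bool" where
  "finitary C \<longleftrightarrow> (\<forall>U\<in>Obj C. \<forall>V\<in>Obj C. \<forall>n. finite (Ext C n U V))"

definition hereditary :: "('o, 'm, 'z) precat_scheme \<Rightarrow> bool" where
  "hereditary C \<longleftrightarrow> (\<forall>U\<in>Obj C. \<forall>V\<in>Obj C. \<forall>n\<ge>2. Ext_vanishes C n U V)"

section \<open>Subobjects\<close>

text \<open>A subobject of \<open>V\<close> is an equivalence class of monomorphisms into \<open>V\<close>.\<close>

definition subobject :: "('o, 'm, 'z) precat_scheme \<Rightarrow> 'm \<Rightarrow> 'm set" where
  "subobject C k = {l. is_mono C l \<and> Tgt C l = Tgt C k \<and>
    (\<exists>h\<in>Hom C (Src C l) (Src C k). is_iso C h \<and> l = k \<diamond>\<^bsub>C\<^esub> h)}"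

definition Subobjects :: "('o, 'm, 'z) precat_scheme \<Rightarrow> 'o \<Rightarrow> 'm set set" where
  "Subobjects C V = {subobject C k | k. is_mono C k \<and> Tgt C k = V}"

definition is_coker_obj :: "('o, 'm, 'z) precat_scheme \<Rightarrow> 'm \<Rightarrow> 'o \<Rightarrow> bool" where
  "is_coker_obj C f U \<longleftrightarrow> (\<exists>c. is_cokernel C c f \<and> isomorphic C (Tgt C c) U)"

definition Hall_set :: "('o, 'm, 'z) precat_scheme \<Rightarrow> 'o \<Rightarrow> 'o \<Rightarrow> 'o \<Rightarrow> 'm set set" where
  "Hall_set C U W V =
    {R \<in> Subobjects C V. \<exists>k\<in>R. isomorphic C (Src C k) W \<and> is_coker_obj C k U}"

definition cofinitary :: "('o, 'm, 'z) precat_scheme \<Rightarrow> bool" where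
  "cofinitary C \<longleftrightarrow> (\<forall>V\<in>Obj C.
    finite {(isoclass C U, isoclass C W) | U W. U \<in> Obj C \<and> W \<in> Obj C \<and> Hall_set C U W V \<noteq> {}})"

text \<open>Flags \<open>0 = V\<^sub>m \<subseteq> \<dots> \<subseteq> V\<^sub>0 = V\<close>, where \<open>V\<^sub>k\<^sub>-\<^sub>1/V\<^sub>k\<close> is a direct sum of \<open>a k\<close> copies of \<open>T k\<close>
  for \<open>k = 1, \<dots>, m\<close>.\<close>

definition Flags ::
  "('o, 'm, 'z) precat_scheme \<Rightarrow> nat \<Rightarrow> (nat \<Rightarrow> 'o) \<Rightarrow> (nat \<Rightarrow> nat) \<Rightarrow> 'o \<Rightarrow> (nat \<Rightarrow> 'm set) set" where
  "Flags C m T a V = {F \<in> {0..m} \<rightarrow>\<^sub>E Subobjects C V.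
    Idn C V \<in> F 0 \<and> (\<exists>r\<in>F m. is_zero_obj C (Src C r)) \<and>
    (\<forall>k\<in>{1..m}. \<exists>r\<in>F (k - 1). \<exists>r'\<in>F k. \<exists>h\<in>Hom C (Src C r') (Src C r).
      r' = r \<diamond>\<^bsub>C\<^esub> h \<and> (\<exists>D. is_power C (a k) (T k) D \<and> is_coker_obj C h D))}"

section \<open>The Euler form and the Grothendieck group\<close>

text \<open>\<^const>\<open>Prod_any\<close> multiplies the finitely many factors different from 1; in a hereditary
  category all factors with \<open>n \<ge> 2\<close> are 1.\<close>

definition euler :: "('o, 'm, 'z) precat_scheme \<Rightarrow> 'o \<Rightarrow> 'o \<Rightarrow> real" where
  "euler C V W = Prod_any (\<lambda>n. real (card (Ext C n V W)) powr ((- 1) ^ n / 2))"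

text \<open>The subfield of the reals generated by the square roots of the values of the Euler form.
  That a field \<open>'k\<close> contains these real numbers means that this subfield comes with
  an embedding into \<open>'k\<close>; below, this embedding is the parameter \<open>emb\<close>.\<close>

definition euler_field :: "('o, 'm, 'z) precat_scheme \<Rightarrow> real set" where
  "euler_field C = generate_field ring_of_type_algebra
    {sqrt (euler C V W) | V W. V \<in> Obj C \<and> W \<in> Obj C}"

definition euler_embedding :: "('o, 'm, 'z) precat_scheme \<Rightarrow> (real \<Rightarrow> 'k::field) \<Rightarrow> bool" where
  "euler_embedding C emb \<longleftrightarrow>
    emb \<in> ring_hom (ring_of_type_algebra\<lparr>carrier := euler_field C\<rparr>) ring_of_type_algebra"

definition short_exact :: "('o, 'm, 'z) precat_scheme \<Rightarrow> 'm \<Rightarrow> 'm \<Rightarrow> bool" where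
  "short_exact C f g \<longleftrightarrow> is_kernel C f g \<and> is_cokernel C g f"

definition K_relations :: "('o, 'm, 'z) precat_scheme \<Rightarrow> ('o set \<Rightarrow>\<^sub>0 int) set" where
  "K_relations C = generate (free_Abelian_group (Isoclasses C))
    {frag_of (isoclass C (Src C g)) - frag_of (isoclass C (Src C f))
      - frag_of (isoclass C (Tgt C g)) | f g. short_exact C f g}"

definition K_group :: "('o, 'm, 'z) precat_scheme \<Rightarrow> ('o set \<Rightarrow>\<^sub>0 int) set monoid" where
  "K_group C = free_Abelian_group (Isoclasses C) Mod K_relations C"

definition K_class :: "('o, 'm, 'z) precat_scheme \<Rightarrow> 'o \<Rightarrow> ('o set \<Rightarrow>\<^sub>0 int) set" where
  "K_class C V = K_relations C #>\<^bsub>free_Abelian_group (Isoclasses C)\<^esub> frag_of (isoclass C V)"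

definition euler_character ::
  "('o, 'm, 'z) precat_scheme \<Rightarrow> (real \<Rightarrow> 'k::field) \<Rightarrow> (('o set \<Rightarrow>\<^sub>0 int) set \<Rightarrow> 'k) \<Rightarrow> bool" where
  "euler_character C emb f \<longleftrightarrow>
    f \<in> hom (K_group C) (mult_of ring_of_type_algebra) \<and>
    (\<forall>T. is_simple C T \<longrightarrow> f (K_class C T) = emb (sqrt (euler C T T)))"

section \<open>Associative algebras\<close>

text \<open>Algebras over a field type \<open>'k\<close> need not be commutative; they use the record type of modules
  as carrier of the operations only.\<close>

definition alg_hom :: "('k, 'a) module \<Rightarrow> ('k, 'b) module \<Rightarrow> ('a \<Rightarrow> 'b) set" where
  "alg_hom A B = {h \<in> ring_hom A B. \<forall>c. \<forall>x\<in>carrier A. h (c \<odot>\<^bsub>A\<^esub> x) = c \<odot>\<^bsub>B\<^esub> h x}"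

definition generated_subalgebra :: "('k, 'a) module \<Rightarrow> 'a set \<Rightarrow> ('k, 'a) module" where
  "generated_subalgebra A D = A\<lparr>carrier := \<Inter>{B. subring B A \<and>
    (\<forall>c. \<forall>x\<in>B. c \<odot>\<^bsub>A\<^esub> x \<in> B) \<and> D \<subseteq> B}\<rparr>"

definition quotient_algebra :: "('k, 'a) module \<Rightarrow> 'a set \<Rightarrow> ('k, 'a set) module" where
  "quotient_algebra A J = \<lparr>carrier = carrier (A Quot J), monoid.mult = monoid.mult (A Quot J),
    one = one (A Quot J), ring.zero = ring.zero (A Quot J), add = add (A Quot J),
    module.smult = (\<lambda>c D. \<Union>x\<in>D. J +>\<^bsub>A\<^esub> (c \<odot>\<^bsub>A\<^esub> x))\<rparr>"

definition basis_vec :: "'b \<Rightarrow> 'b \<Rightarrow> 'k::field" where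
  "basis_vec b = (\<lambda>c. if c = b then 1 else 0)"

text \<open>The free algebra on a set \<open>L\<close> of generators: its basis consists of the words in \<open>L\<close>.\<close>

definition free_algebra :: "'l set \<Rightarrow> ('k::field, 'l list \<Rightarrow> 'k) module" where
  "free_algebra L = \<lparr>carrier = {x. finite {w. x w \<noteq> 0} \<and> {w. x w \<noteq> 0} \<subseteq> lists L},
    monoid.mult = (\<lambda>x y w. \<Sum>j\<le>length w. x (take j w) * y (drop j w)),
    one = basis_vec [], ring.zero = (\<lambda>w. 0), add = (\<lambda>x y w. x w + y w),
    module.smult = (\<lambda>c x w. c * x w)\<rparr>"

section \<open>The dual Hall-Ringel algebra\<close>

definition Hall_coeff ::
  "('o, 'm, 'z) precat_scheme \<Rightarrow> (real \<Rightarrow> 'k::field_char_0) \<Rightarrow> 'o \<Rightarrow> 'o \<Rightarrow> 'o \<Rightarrow> 'k" where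
  "Hall_coeff C emb U W V = emb (euler C U W) * of_nat (card (Hall_set C U W V)) *
    (of_nat (card (Aut C U)) * of_nat (card (Aut C W)) / of_nat (card (Aut C V)))"

text \<open>\<open>rep\<close> picks an object from an isomorphism class; \<^const>\<open>Hall_coeff\<close> depends only on the
  isomorphism classes of its arguments.\<close>

definition rep :: "'o set \<Rightarrow> 'o" where
  "rep c = (SOME V. V \<in> c)"

definition Hall_algebra ::
  "('o, 'm, 'z) precat_scheme \<Rightarrow> (real \<Rightarrow> 'k::field_char_0) \<Rightarrow> ('k, 'o set \<Rightarrow> 'k) module" where
  "Hall_algebra C emb = \<lparr>carrier = {x. finite {c. x c \<noteq> 0} \<and> {c. x c \<noteq> 0} \<subseteq> Isoclasses C},
    monoid.mult = (\<lambda>x y v. if v \<in> Isoclasses C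
      then \<Sum>u | x u \<noteq> 0. \<Sum>w | y w \<noteq> 0. x u * y w * Hall_coeff C emb (rep u) (rep w) (rep v)
      else 0),
    one = basis_vec {Z. is_zero_obj C Z}, ring.zero = (\<lambda>v. 0), add = (\<lambda>x y v. x v + y v),
    module.smult = (\<lambda>c x v. c * x v)\<rparr>"

text \<open>\<open>[V]\<^sup>*\<close>, where \<open>f\<close> is the homomorphism characterised by \<^const>\<open>euler_character\<close>.\<close>

definition dual_elt :: "('o, 'm, 'z) precat_scheme \<Rightarrow> (real \<Rightarrow> 'k::field_char_0) \<Rightarrow>
    (('o set \<Rightarrow>\<^sub>0 int) set \<Rightarrow> 'k) \<Rightarrow> 'o \<Rightarrow> 'o set \<Rightarrow> 'k" where
  "dual_elt C emb f V = (emb (euler C V V powr (- 1 / 2)) * f (K_class C V))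
    \<odot>\<^bsub>Hall_algebra C emb\<^esub> basis_vec (isoclass C V)"

definition U_plus :: "('o, 'm, 'z) precat_scheme \<Rightarrow> (real \<Rightarrow> 'k::field_char_0) \<Rightarrow>
    (('o set \<Rightarrow>\<^sub>0 int) set \<Rightarrow> 'k) \<Rightarrow> ('i \<Rightarrow> 'o) \<Rightarrow> 'i set \<Rightarrow> ('k, 'o set \<Rightarrow> 'k) module" where
  "U_plus C emb f S I =
    generated_subalgebra (Hall_algebra C emb) ((\<lambda>j. dual_elt C emb f (S j)) ` I)"

section \<open>The quantum polynomial algebra and the quantum cluster character\<close>

text \<open>In this section \<open>T k\<close> stands for the simple object with index \<open>i\<^sub>k\<close>, for \<open>k = 1, \<dots>, m\<close>.\<close>

definition P_ideal :: "('o, 'm, 'z) precat_scheme \<Rightarrow> (real \<Rightarrow> 'k::field_char_0) \<Rightarrow> nat \<Rightarrow>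
    (nat \<Rightarrow> 'o) \<Rightarrow> (nat list \<Rightarrow> 'k) set" where
  "P_ideal C emb m T = genideal (free_algebra {1..m})
    {(\<lambda>w. basis_vec [l, k] w - emb (euler C (T k) (T l) * euler C (T l) (T k)) * basis_vec [k, l] w)
      | k l. 1 \<le> k \<and> k < l \<and> l \<le> m}"

definition P_algebra :: "('o, 'm, 'z) precat_scheme \<Rightarrow> (real \<Rightarrow> 'k::field_char_0) \<Rightarrow> nat \<Rightarrow>
    (nat \<Rightarrow> 'o) \<Rightarrow> ('k, (nat list \<Rightarrow> 'k) set) module" where
  "P_algebra C emb m T = quotient_algebra (free_algebra {1..m}) (P_ideal C emb m T)"

definition P_gen :: "('o, 'm, 'z) precat_scheme \<Rightarrow> (real \<Rightarrow> 'k::field_char_0) \<Rightarrow> nat \<Rightarrow>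
    (nat \<Rightarrow> 'o) \<Rightarrow> nat \<Rightarrow> (nat list \<Rightarrow> 'k) set" where
  "P_gen C emb m T k = P_ideal C emb m T +>\<^bsub>free_algebra {1..m}\<^esub> basis_vec [k]"

definition P_monomial :: "('o, 'm, 'z) precat_scheme \<Rightarrow> (real \<Rightarrow> 'k::field_char_0) \<Rightarrow> nat \<Rightarrow>
    (nat \<Rightarrow> 'o) \<Rightarrow> (nat \<Rightarrow> nat) \<Rightarrow> (nat list \<Rightarrow> 'k) set" where
  "P_monomial C emb m T a = foldr
    (\<lambda>k y. (P_gen C emb m T k [^]\<^bsub>P_algebra C emb m T\<^esub> a k) \<otimes>\<^bsub>P_algebra C emb m T\<^esub> y)
    [1..<Suc m] \<one>\<^bsub>P_algebra C emb m T\<^esub>"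

text \<open>The sum defining \<open>X\<^sub>V\<close> is restricted to the (finitely many) exponents \<open>a\<close> that admit a flag;
  all other summands are zero.\<close>

definition X_char :: "('o, 'm, 'z) precat_scheme \<Rightarrow> (real \<Rightarrow> 'k::field_char_0) \<Rightarrow> nat \<Rightarrow>
    (nat \<Rightarrow> 'o) \<Rightarrow> 'o \<Rightarrow> (nat list \<Rightarrow> 'k) set" where
  "X_char C emb m T V = finsum (P_algebra C emb m T)
    (\<lambda>a. (emb (\<Prod>l\<in>{1..m}. \<Prod>k\<in>{1..<l}.
              (euler C (T k) (T l) / euler C (T l) (T k)) powr (real (a k * a l) / 2))
           * of_nat (card (Flags C m T a V))) \<odot>\<^bsub>P_algebra C emb m T\<^esub> P_monomial C emb m T a)
    {a \<in> {1..m} \<rightarrow>\<^sub>E UNIV. Flags C m T a V \<noteq> {}}"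

end

theory Submission
  imports Defs
begin

text \<open>The algebra \<open>U\<^sub>+\<^sup>*\<close> is generated by the \<open>[S\<^sub>j]\<^sup>*\<close>, so a homomorphism on it is determined by its
  values there, and it remains to compute \<open>X\<^sub>V\<close> for a simple object \<open>V\<close>.  The members of a flag of
  subobjects of \<open>V\<close> are \<open>V\<close> up to some index and \<open>0\<close> from then on.  If the jump happens at step \<open>k\<close>,
  then \<open>V\<close> is a power of \<open>T k\<close>, hence isomorphic to \<open>T k\<close>, and the exponent is the \<open>k\<close>-th unit
  vector.  Such an exponent admits exactly one flag, and its scalar factor is 1, so that it
  contributes \<open>t\<^sub>k\<close>.  Restriction to \<open>U\<^sub>+\<^sup>*\<close> makes sense because products in the Hall algebra have
  finite support: the middle terms of extensions of \<open>U\<close> by \<open>W\<close> form finitely many isomorphism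
  classes, as \<open>Ext\<^sup>1(U, W)\<close> is finite.\<close>

section \<open>Preadditive categories\<close>

text \<open>The value of each summand depends on a convention for real powers:
  \<open>0 powr 0\<close> is 0, so an exponent 0 gives the factor 1 only if the quotient of Euler
  values is nonzero. This is the reason for proving \<open>euler\<close> positive, which asks every
  \<open>Ext\<close> set to be finite and nonempty; degree 1 is where the split extension enters.
  Counting exactly one flag is possible because the members of a flag are classes of monomorphisms
  and because flags and exponents are functions fixed outside their index range. The carrier of the
  subalgebra is an intersection over all scalar-closed subrings containing the generators, and an
  empty intersection would be the whole type; so the carrier of the Hall algebra has to be exhibited
  as one of these subrings, and finite support of products provides this. Uniqueness exhibits
  another such subring, the set where two homomorphisms agree. The short five lemma links
  \<open>Ext\<close> classes to middle terms.\<close>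

context category
begin

lemma HomD:
  assumes "f \<in> Hom C A B"
  shows "f \<in> Arr C" "Src C f = A" "Tgt C f = B" "A \<in> Obj C" "B \<in> Obj C"
  using assms src_obj tgt_obj by (auto simp: Hom_def)

lemma is_monoI:
  assumes "f \<in> Hom C A B"
    and "\<And>Y g h. g \<in> Hom C Y A \<Longrightarrow> h \<in> Hom C Y A \<Longrightarrow> f \<diamond> g = f \<diamond> h \<Longrightarrow> g = h"
  shows "is_mono C f"
  using assms by (auto simp: is_mono_def Hom_def)

lemma is_monoD:
  "is_mono C f \<Longrightarrow> f \<in> Hom C A B \<Longrightarrow> g \<in> Hom C Y A \<Longrightarrow> h \<in> Hom C Y A \<Longrightarrow> f \<diamond> g = f \<diamond> h \<Longrightarrow> g = h"
  by (auto simp: is_mono_def Hom_def)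

lemma is_epiI:
  assumes "f \<in> Hom C A B"
    and "\<And>Y g h. g \<in> Hom C B Y \<Longrightarrow> h \<in> Hom C B Y \<Longrightarrow> g \<diamond> f = h \<diamond> f \<Longrightarrow> g = h"
  shows "is_epi C f"
  using assms by (auto simp: is_epi_def Hom_def)

lemma is_epiD:
  "is_epi C f \<Longrightarrow> f \<in> Hom C A B \<Longrightarrow> g \<in> Hom C B Y \<Longrightarrow> h \<in> Hom C B Y \<Longrightarrow> g \<diamond> f = h \<diamond> f \<Longrightarrow> g = h"
  by (auto simp: is_epi_def Hom_def)

lemma is_isoI:
  "f \<in> Hom C A B \<Longrightarrow> g \<in> Hom C B A \<Longrightarrow> g \<diamond> f = Idn C A \<Longrightarrow> f \<diamond> g = Idn C B \<Longrightarrow> is_iso C f"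
  by (auto simp: is_iso_def Hom_def)

lemma is_isoE:
  assumes "is_iso C f" "f \<in> Hom C A B"
  obtains g where "g \<in> Hom C B A" "g \<diamond> f = Idn C A" "f \<diamond> g = Idn C B" "is_iso C g"
proof -
  from assms obtain g where g: "g \<in> Hom C B A" "g \<diamond> f = Idn C A" "f \<diamond> g = Idn C B"
    by (auto simp: is_iso_def Hom_def)
  then show thesis using is_isoI[OF g(1) assms(2)] that by blast
qed

lemma split_mono_is_mono:
  assumes f: "f \<in> Hom C A B" and g: "g \<in> Hom C B A" and gf: "g \<diamond> f = Idn C A"
  shows "is_mono C f"
proof (rule is_monoI[OF f])
  fix Y x y assume x: "x \<in> Hom C Y A" and y: "y \<in> Hom C Y A" and eq: "f \<diamond> x = f \<diamond> y"
  have "x = (g \<diamond> f) \<diamond> x" using idn_cmp[OF x] gf by simp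
  also have "\<dots> = (g \<diamond> f) \<diamond> y" using cmp_assoc[OF x f g] cmp_assoc[OF y f g] eq by simp
  also have "\<dots> = y" using idn_cmp[OF y] gf by simp
  finally show "x = y" .
qed

lemma split_epi_is_epi:
  assumes f: "f \<in> Hom C A B" and g: "g \<in> Hom C B A" and fg: "f \<diamond> g = Idn C B"
  shows "is_epi C f"
proof (rule is_epiI[OF f])
  fix Y x y assume x: "x \<in> Hom C B Y" and y: "y \<in> Hom C B Y" and eq: "x \<diamond> f = y \<diamond> f"
  have "x = x \<diamond> (f \<diamond> g)" using cmp_idn[OF x] fg by simp
  also have "\<dots> = y \<diamond> (f \<diamond> g)" using cmp_assoc[OF g f x] cmp_assoc[OF g f y] eq by simp
  also have "\<dots> = y" using cmp_idn[OF y] fg by simp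
  finally show "x = y" .
qed

lemma iso_is_mono: "is_iso C f \<Longrightarrow> f \<in> Hom C A B \<Longrightarrow> is_mono C f"
  by (erule is_isoE, assumption) (rule split_mono_is_mono)

lemma iso_is_epi: "is_iso C f \<Longrightarrow> f \<in> Hom C A B \<Longrightarrow> is_epi C f"
  by (erule is_isoE, assumption) (rule split_epi_is_epi)

lemma mono_cmp:
  assumes f: "f \<in> Hom C A B" "is_mono C f" and g: "g \<in> Hom C B D" "is_mono C g"
  shows "is_mono C (g \<diamond> f)"
proof (rule is_monoI[OF cmp_hom[OF f(1) g(1)]])
  fix Y x y assume x: "x \<in> Hom C Y A" and y: "y \<in> Hom C Y A" and "(g \<diamond> f) \<diamond> x = (g \<diamond> f) \<diamond> y"
  then have "g \<diamond> f \<diamond> x = g \<diamond> f \<diamond> y" by (simp add: cmp_assoc[OF _ f(1) g(1)])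
  then have "f \<diamond> x = f \<diamond> y" by (rule is_monoD[OF g(2,1) cmp_hom[OF x f(1)] cmp_hom[OF y f(1)]])
  then show "x = y" by (rule is_monoD[OF f(2,1) x y])
qed

lemma epi_cmp:
  assumes f: "f \<in> Hom C A B" "is_epi C f" and g: "g \<in> Hom C B D" "is_epi C g"
  shows "is_epi C (g \<diamond> f)"
proof (rule is_epiI[OF cmp_hom[OF f(1) g(1)]])
  fix Y x y assume x: "x \<in> Hom C D Y" and y: "y \<in> Hom C D Y" and "x \<diamond> g \<diamond> f = y \<diamond> g \<diamond> f"
  then have "(x \<diamond> g) \<diamond> f = (y \<diamond> g) \<diamond> f" by (simp add: cmp_assoc[OF f(1) g(1)])
  then have "x \<diamond> g = y \<diamond> g" by (rule is_epiD[OF f(2,1) cmp_hom[OF g(1) x] cmp_hom[OF g(1) y]])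
  then show "x = y" by (rule is_epiD[OF g(2,1) x y])
qed

lemma mono_cancel:
  assumes f: "f \<in> Hom C A B" and g: "g \<in> Hom C B D" and "is_mono C (g \<diamond> f)"
  shows "is_mono C f"
proof (rule is_monoI[OF f])
  fix Y x y assume x: "x \<in> Hom C Y A" and y: "y \<in> Hom C Y A" and "f \<diamond> x = f \<diamond> y"
  then have "(g \<diamond> f) \<diamond> x = (g \<diamond> f) \<diamond> y"
    by (simp add: cmp_assoc[OF x f g] cmp_assoc[OF y f g])
  then show "x = y" by (rule is_monoD[OF assms(3) cmp_hom[OF f g] x y])
qed

lemma idn_iso: "A \<in> Obj C \<Longrightarrow> is_iso C (Idn C A)"
  using is_isoI[OF idn_hom idn_hom] idn_cmp[OF idn_hom] by blast

lemma iso_cmp: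
  assumes f: "f \<in> Hom C A B" "is_iso C f" and g: "g \<in> Hom C B D" "is_iso C g"
  shows "is_iso C (g \<diamond> f)"
proof -
  obtain f' where f': "f' \<in> Hom C B A" "f' \<diamond> f = Idn C A" "f \<diamond> f' = Idn C B"
    using is_isoE[OF f(2,1)] by metis
  obtain g' where g': "g' \<in> Hom C D B" "g' \<diamond> g = Idn C B" "g \<diamond> g' = Idn C D"
    using is_isoE[OF g(2,1)] by metis
  show ?thesis
  proof (rule is_isoI[OF cmp_hom[OF f(1) g(1)] cmp_hom[OF g'(1) f'(1)]])
    have "(f' \<diamond> g') \<diamond> g \<diamond> f = f' \<diamond> (g' \<diamond> g) \<diamond> f"
      by (simp add: cmp_assoc[OF f(1) g(1) g'(1)] cmp_assoc[OF cmp_hom[OF f(1) g(1)] g'(1) f'(1)])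
    then show "(f' \<diamond> g') \<diamond> g \<diamond> f = Idn C A" by (simp add: g'(2) idn_cmp[OF f(1)] f'(2))
    have "(g \<diamond> f) \<diamond> f' \<diamond> g' = g \<diamond> (f \<diamond> f') \<diamond> g'"
      by (simp add: cmp_assoc[OF g'(1) f'(1) f(1)] cmp_assoc[OF cmp_hom[OF g'(1) f'(1)] f(1) g(1)])
    then show "(g \<diamond> f) \<diamond> f' \<diamond> g' = Idn C D" by (simp add: f'(3) idn_cmp[OF g'(1)] g'(3))
  qed
qed

lemma isomorphicI: "f \<in> Hom C A B \<Longrightarrow> is_iso C f \<Longrightarrow> isomorphic C A B"
  by (auto simp: isomorphic_def)

lemma isomorphic_refl: "A \<in> Obj C \<Longrightarrow> isomorphic C A A"
  using idn_hom idn_iso isomorphicI by blast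

lemma isomorphic_sym: "isomorphic C A B \<Longrightarrow> isomorphic C B A"
  unfolding isomorphic_def by (blast elim: is_isoE)

lemma isomorphic_trans: "isomorphic C A B \<Longrightarrow> isomorphic C B D \<Longrightarrow> isomorphic C A D"
  unfolding isomorphic_def by (meson iso_cmp cmp_hom)

lemma isoclass_eq_iff:
  assumes "A \<in> Obj C" "B \<in> Obj C"
  shows "isoclass C A = isoclass C B \<longleftrightarrow> isomorphic C A B"
proof
  assume "isoclass C A = isoclass C B"
  moreover have "B \<in> isoclass C B" using assms isomorphic_refl by (simp add: isoclass_def)
  ultimately show "isomorphic C A B" unfolding isoclass_def by blast
next
  assume "isomorphic C A B"
  then show "isoclass C A = isoclass C B"
    unfolding isoclass_def using isomorphic_sym isomorphic_trans by blast
qed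

lemma rep_isoclass:
  assumes "v \<in> Isoclasses C"
  shows "rep v \<in> Obj C" "isoclass C (rep v) = v"
proof -
  obtain A where A: "A \<in> Obj C" "v = isoclass C A" using assms by (auto simp: Isoclasses_def)
  then have "A \<in> v" using isomorphic_refl by (simp add: isoclass_def)
  then have "rep v \<in> v" unfolding rep_def by (rule someI)
  then show "rep v \<in> Obj C" "isoclass C (rep v) = v"
    using A isoclass_eq_iff[of A "rep v"] by (simp_all add: isoclass_def)
qed

text \<open>The isomorphism \<open>h\<close> with \<open>l = k \<diamond> h\<close> has an inverse,
  so an arrow differs from \<open>l\<close> by an isomorphism exactly when it differs from
  \<open>k\<close> by one. A subobject is thereby determined by any of its members.\<close>

lemma subobject_eq:
  assumes k: "k \<in> Hom C A V" and l: "l \<in> subobject C k"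
  shows "subobject C l = subobject C k"
proof -
  obtain h where h: "h \<in> Hom C (Src C l) A" "is_iso C h" "l = k \<diamond> h"
    and lV: "l \<in> Hom C (Src C l) V"
    using k l by (auto simp: subobject_def is_mono_def Hom_def)
  obtain g where g: "g \<in> Hom C A (Src C l)" "is_iso C g" "h \<diamond> g = Idn C A"
    using is_isoE[OF h(2,1)] by metis
  have kl: "k = l \<diamond> g" by (simp add: h(3) cmp_assoc[OF g(1) h(1) k] g(3) cmp_idn[OF k])
  have *: "(\<exists>e\<in>Hom C Y (Src C l). is_iso C e \<and> x = l \<diamond> e) \<longleftrightarrow> (\<exists>e\<in>Hom C Y A. is_iso C e \<and> x = k \<diamond> e)"
    for x Y
  proof
    assume "\<exists>e\<in>Hom C Y (Src C l). is_iso C e \<and> x = l \<diamond> e"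
    then obtain e where e: "e \<in> Hom C Y (Src C l)" "is_iso C e" "x = l \<diamond> e" by blast
    then show "\<exists>e\<in>Hom C Y A. is_iso C e \<and> x = k \<diamond> e"
      using h k by (intro bexI[of _ "h \<diamond> e"]) (auto intro: iso_cmp cmp_hom simp: cmp_assoc[OF e(1) h(1) k])
  next
    assume "\<exists>e\<in>Hom C Y A. is_iso C e \<and> x = k \<diamond> e"
    then obtain e where e: "e \<in> Hom C Y A" "is_iso C e" "x = k \<diamond> e" by blast
    have "x = l \<diamond> g \<diamond> e" using e kl cmp_assoc[OF e(1) g(1) lV] by simp
    then show "\<exists>e\<in>Hom C Y (Src C l). is_iso C e \<and> x = l \<diamond> e"
      using e g by (intro bexI[of _ "g \<diamond> e"]) (auto intro: iso_cmp cmp_hom)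
  qed
  show ?thesis using * HomD[OF k] HomD[OF lV] by (simp add: subobject_def)
qed

lemma SubobjectsD:
  assumes R: "R \<in> Subobjects C V" and r: "r \<in> R"
  shows "is_mono C r" "r \<in> Hom C (Src C r) V" "R = subobject C r"
proof -
  obtain k where k: "is_mono C k" "Tgt C k = V" "R = subobject C k"
    using R by (auto simp: Subobjects_def)
  then show "is_mono C r" "r \<in> Hom C (Src C r) V"
    using r by (auto simp: subobject_def is_mono_def Hom_def)
  show "R = subobject C r"
    using k r subobject_eq[of k "Src C k" V r] by (auto simp: is_mono_def Hom_def)
qed

lemma subobject_self:
  assumes "is_mono C k" "k \<in> Hom C A V"
  shows "k \<in> subobject C k"
proof -
  have "Idn C A \<in> Hom C (Src C k) (Src C k)" "is_iso C (Idn C A)" "k = k \<diamond> Idn C A"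
    using HomD[OF assms(2)] idn_hom idn_iso cmp_idn[OF assms(2)] by auto
  then show ?thesis using assms(1) unfolding subobject_def by blast
qed

lemma subobject_in_Subobjects:
  "is_mono C k \<Longrightarrow> k \<in> Hom C A V \<Longrightarrow> subobject C k \<in> Subobjects C V"
  unfolding Subobjects_def Hom_def by blast

end

section \<open>Zero morphisms, kernels and cokernels\<close>

context preadditive_category
begin

lemma zro_hom: "A \<in> Obj C \<Longrightarrow> B \<in> Obj C \<Longrightarrow> Zro C A B \<in> Hom C A B"
proof -
  assume AB: "A \<in> Obj C" "B \<in> Obj C"
  interpret comm_group "hom_group C A B" by (rule hom_group[OF AB])
  show ?thesis using one_closed by (simp add: hom_group_def)
qed

lemma pls_hom:
  assumes "x \<in> Hom C A B" "y \<in> Hom C A B"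
  shows "Pls C x y \<in> Hom C A B"
proof -
  interpret comm_group "hom_group C A B" by (rule hom_group[OF HomD(4,5)[OF assms(1)]])
  show ?thesis using assms m_closed[of x y] by (simp add: hom_group_def)
qed

text \<open>Cancellation in the Hom group. By bilinearity a composite \<open>x\<close> with a zero
  arrow satisfies \<open>x + x = x\<close>, and this is how such composites are recognised as
  zero.\<close>

lemma pls_eq_self_imp_zro:
  assumes "x \<in> Hom C A B" "Pls C x x = x"
  shows "x = Zro C A B"
proof -
  interpret comm_group "hom_group C A B" by (rule hom_group[OF HomD(4,5)[OF assms(1)]])
  have "x \<otimes>\<^bsub>hom_group C A B\<^esub> x = x" "x \<in> carrier (hom_group C A B)"
    using assms by (simp_all add: hom_group_def)
  then have "x = \<one>\<^bsub>hom_group C A B\<^esub>" using l_cancel_one by blast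
  then show ?thesis by (simp add: hom_group_def)
qed

lemma pls_zro: 
  assumes "x \<in> Hom C A B" 
  shows "Pls C x (Zro C A B) = x" "Pls C (Zro C A B) x = x"
proof -
  interpret comm_group "hom_group C A B" by (rule hom_group[OF HomD(4,5)[OF assms(1)]])
  show "Pls C x (Zro C A B) = x" "Pls C (Zro C A B) x = x"
    using assms r_one[of x] l_one[of x] by (simp_all add: hom_group_def)
qed

lemma zro_cmp:
  assumes f: "f \<in> Hom C A B" and D: "D \<in> Obj C"
  shows "Zro C B D \<diamond> f = Zro C A D"
proof -
  have z: "Zro C B D \<in> Hom C B D" using zro_hom HomD[OF f] D by blast
  show ?thesis
    by (rule pls_eq_self_imp_zro[OF cmp_hom[OF f z]])
      (simp flip: cmp_pls_left[OF f z z] add: pls_zro[OF z])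
qed

lemma cmp_zro:
  assumes f: "f \<in> Hom C B D" and A: "A \<in> Obj C"
  shows "f \<diamond> Zro C A B = Zro C A D"
proof -
  have z: "Zro C A B \<in> Hom C A B" using zro_hom HomD[OF f] A by blast
  show ?thesis
    by (rule pls_eq_self_imp_zro[OF cmp_hom[OF z f]])
      (simp flip: cmp_pls_right[OF z z f] add: pls_zro[OF z])
qed

text \<open>The last clause is cancellation: it reduces a proof of \<open>g = h\<close> to showing
  that \<open>g + n\<close> is zero, where \<open>n\<close> is the negative of
  \<open>h\<close>.\<close>

lemma neg_exists:
  assumes "h \<in> Hom C A B"
  obtains n where "n \<in> Hom C A B" "Pls C h n = Zro C A B"
    "\<And>g. g \<in> Hom C A B \<Longrightarrow> Pls C g n = Zro C A B \<Longrightarrow> g = h"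
proof -
  interpret comm_group "hom_group C A B" by (rule hom_group[OF HomD(4,5)[OF assms(1)]])
  have h: "h \<in> carrier (hom_group C A B)" using assms by (simp add: hom_group_def)
  have "inv\<^bsub>hom_group C A B\<^esub> h \<in> Hom C A B"
    using inv_closed[OF h] by (simp add: hom_group_def)
  moreover have "Pls C h (inv\<^bsub>hom_group C A B\<^esub> h) = Zro C A B"
    using r_inv[OF h] by (simp add: hom_group_def)
  moreover have "g = h" if "g \<in> Hom C A B" "Pls C g (inv\<^bsub>hom_group C A B\<^esub> h) = Zro C A B" for g
  proof -
    have "g \<otimes>\<^bsub>hom_group C A B\<^esub> inv\<^bsub>hom_group C A B\<^esub> h = h \<otimes>\<^bsub>hom_group C A B\<^esub> inv\<^bsub>hom_group C A B\<^esub> h"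
      "g \<in> carrier (hom_group C A B)"
      using that r_inv[OF h] by (simp_all add: hom_group_def)
    then show ?thesis using h r_cancel inv_closed by blast
  qed
  ultimately show thesis using that by blast
qed

text \<open>If \<open>f\<close> has equal composites with \<open>g\<close> and \<open>h\<close>, it
  kills their difference, so cancellability need only be tested against zero.\<close>

lemma mono_zroI:
  assumes f: "f \<in> Hom C A B"
    and z: "\<And>Y g. g \<in> Hom C Y A \<Longrightarrow> f \<diamond> g = Zro C Y B \<Longrightarrow> g = Zro C Y A"
  shows "is_mono C f"
proof (rule is_monoI[OF f])
  fix Y g h assume g: "g \<in> Hom C Y A" and h: "h \<in> Hom C Y A" and eq: "f \<diamond> g = f \<diamond> h"
  obtain n where n: "n \<in> Hom C Y A" "Pls C h n = Zro C Y A"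
    "Pls C g n = Zro C Y A \<Longrightarrow> g = h"
    using neg_exists[OF h] g by metis
  have "Pls C g n \<in> Hom C Y A" by (rule pls_hom[OF g n(1)])
  moreover have "f \<diamond> Pls C g n = f \<diamond> Pls C h n"
    using cmp_pls_right[OF g n(1) f] cmp_pls_right[OF h n(1) f] eq by simp
  then have "f \<diamond> Pls C g n = Zro C Y B" using n(2) cmp_zro[OF f] HomD[OF g] by simp
  ultimately show "g = h" using z n(3) by blast
qed

lemma epi_zroI:
  assumes f: "f \<in> Hom C A B"
    and z: "\<And>Y g. g \<in> Hom C B Y \<Longrightarrow> g \<diamond> f = Zro C A Y \<Longrightarrow> g = Zro C B Y"
  shows "is_epi C f"
proof (rule is_epiI[OF f])
  fix Y g h assume g: "g \<in> Hom C B Y" and h: "h \<in> Hom C B Y" and eq: "g \<diamond> f = h \<diamond> f"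
  obtain n where n: "n \<in> Hom C B Y" "Pls C h n = Zro C B Y"
    "Pls C g n = Zro C B Y \<Longrightarrow> g = h"
    using neg_exists[OF h] g by metis
  have "Pls C g n \<in> Hom C B Y" by (rule pls_hom[OF g n(1)])
  moreover have "Pls C g n \<diamond> f = Pls C h n \<diamond> f"
    using cmp_pls_left[OF f g n(1)] cmp_pls_left[OF f h n(1)] eq by simp
  then have "Pls C g n \<diamond> f = Zro C A Y" using n(2) zro_cmp[OF f] HomD[OF g] by simp
  ultimately show "g = h" using z n(3) by blast
qed

lemma mono_zroD:
  assumes "is_mono C f" "f \<in> Hom C A B" "g \<in> Hom C Y A" "f \<diamond> g = Zro C Y B"
  shows "g = Zro C Y A"
proof (rule is_monoD[OF assms(1-3)])
  show "Zro C Y A \<in> Hom C Y A" using zro_hom HomD(4)[OF assms(2)] HomD(4)[OF assms(3)] by blast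
  show "f \<diamond> g = f \<diamond> Zro C Y A" using assms(4) cmp_zro[OF assms(2)] HomD(4)[OF assms(3)] by simp
qed

lemma epi_zroD:
  assumes "is_epi C f" "f \<in> Hom C A B" "g \<in> Hom C B Y" "g \<diamond> f = Zro C A Y"
  shows "g = Zro C B Y"
proof (rule is_epiD[OF assms(1-3)])
  show "Zro C B Y \<in> Hom C B Y" using zro_hom HomD(5)[OF assms(2)] HomD(5)[OF assms(3)] by blast
  show "g \<diamond> f = Zro C B Y \<diamond> f" using assms(4) zro_cmp[OF assms(2)] HomD(5)[OF assms(3)] by simp
qed

lemma is_kernelD:
  assumes "is_kernel C k f" "f \<in> Hom C A B"
  shows "k \<in> Hom C (Src C k) A" "f \<diamond> k = Zro C (Src C k) B"
    "\<And>Y g. g \<in> Hom C Y A \<Longrightarrow> f \<diamond> g = Zro C Y B \<Longrightarrow> \<exists>!h. h \<in> Hom C Y (Src C k) \<and> k \<diamond> h = g"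
  using assms unfolding is_kernel_def Hom_def by auto

text \<open>Uniqueness of the factorisation comes from \<open>k\<close> being mono, which leaves
  only its existence to be checked in applications.\<close>

lemma is_kernelI:
  assumes "k \<in> Hom C K A" "f \<in> Hom C A B" "is_mono C k" "f \<diamond> k = Zro C K B"
    "\<And>Y g. g \<in> Hom C Y A \<Longrightarrow> f \<diamond> g = Zro C Y B \<Longrightarrow> \<exists>h. h \<in> Hom C Y K \<and> k \<diamond> h = g"
  shows "is_kernel C k f"
proof -
  have "\<exists>!h. h \<in> Hom C Y K \<and> k \<diamond> h = g" if "g \<in> Hom C Y A" "f \<diamond> g = Zro C Y B" for Y g
    using assms(5)[OF that] is_monoD[OF assms(3,1)] by (smt (verit))
  then show ?thesis using HomD[OF assms(1)] HomD[OF assms(2)] assms(4)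
    by (simp add: is_kernel_def)
qed

lemma is_cokernelD:
  assumes "is_cokernel C c f" "f \<in> Hom C A B"
  shows "c \<in> Hom C B (Tgt C c)" "c \<diamond> f = Zro C A (Tgt C c)"
    "\<And>Y g. g \<in> Hom C B Y \<Longrightarrow> g \<diamond> f = Zro C A Y \<Longrightarrow> \<exists>!h. h \<in> Hom C (Tgt C c) Y \<and> h \<diamond> c = g"
  using assms unfolding is_cokernel_def Hom_def by auto

lemma is_cokernelI:
  assumes "c \<in> Hom C B D" "f \<in> Hom C A B" "is_epi C c" "c \<diamond> f = Zro C A D"
    "\<And>Y g. g \<in> Hom C B Y \<Longrightarrow> g \<diamond> f = Zro C A Y \<Longrightarrow> \<exists>h. h \<in> Hom C D Y \<and> h \<diamond> c = g"
  shows "is_cokernel C c f"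
proof -
  have "\<exists>!h. h \<in> Hom C D Y \<and> h \<diamond> c = g" if "g \<in> Hom C B Y" "g \<diamond> f = Zro C A Y" for Y g
    using assms(5)[OF that] is_epiD[OF assms(3,1)] by (smt (verit))
  then show ?thesis using HomD[OF assms(1)] HomD[OF assms(2)] assms(4)
    by (simp add: is_cokernel_def)
qed

text \<open>Both \<open>g\<close> and \<open>h\<close> are the unique factorisation of the same
  arrow \<open>k \<diamond> g\<close>, which \<open>f\<close> kills.\<close>

lemma kernel_is_mono:
  assumes k: "is_kernel C k f" and f: "f \<in> Hom C A B"
  shows "is_mono C k"
proof (rule is_monoI[OF is_kernelD(1)[OF k f]])
  fix Y g h assume g: "g \<in> Hom C Y (Src C k)" and h: "h \<in> Hom C Y (Src C k)" and eq: "k \<diamond> g = k \<diamond> h"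
  have k1: "k \<in> Hom C (Src C k) A" by (rule is_kernelD[OF k f])
  have "f \<diamond> k \<diamond> g = Zro C Y B"
    using cmp_assoc[OF g k1 f] is_kernelD(2)[OF k f] zro_cmp[OF g] HomD[OF f] by simp
  then show "g = h" using is_kernelD(3)[OF k f cmp_hom[OF g k1]] g h eq by metis
qed

lemma cokernel_is_epi:
  assumes c: "is_cokernel C c f" and f: "f \<in> Hom C A B"
  shows "is_epi C c"
proof (rule is_epiI[OF is_cokernelD(1)[OF c f]])
  fix Y g h assume g: "g \<in> Hom C (Tgt C c) Y" and h: "h \<in> Hom C (Tgt C c) Y" and eq: "g \<diamond> c = h \<diamond> c"
  have c1: "c \<in> Hom C B (Tgt C c)" by (rule is_cokernelD[OF c f])
  have "(g \<diamond> c) \<diamond> f = Zro C A Y"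
    using cmp_assoc[OF f c1 g] is_cokernelD(2)[OF c f] cmp_zro[OF g] HomD[OF f] by simp
  then show "g = h" using is_cokernelD(3)[OF c f cmp_hom[OF c1 g]] g h eq by metis
qed

text \<open>Every arrow into or out of \<open>Z\<close> is a composite with the identity of
  \<open>Z\<close>, hence zero as soon as this identity is. The result is an equational test for
  zero objects.\<close>

lemma is_zero_obj_iff: "is_zero_obj C Z \<longleftrightarrow> Z \<in> Obj C \<and> Idn C Z = Zro C Z Z"
proof
  assume Z: "is_zero_obj C Z"
  then have "Z \<in> Obj C" "\<exists>!f. f \<in> Hom C Z Z" unfolding is_zero_obj_def by blast+
  then show "Z \<in> Obj C \<and> Idn C Z = Zro C Z Z" using idn_hom[of Z] zro_hom[of Z Z] by blast
next
  assume Z: "Z \<in> Obj C \<and> Idn C Z = Zro C Z Z"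
  have "f = Zro C Z A" if "f \<in> Hom C Z A" for f A
    using that Z cmp_idn[OF that] cmp_zro[OF that] by simp
  moreover have "f = Zro C A Z" if "f \<in> Hom C A Z" for f A
    using that Z idn_cmp[OF that] zro_cmp[OF that] by simp
  ultimately show "is_zero_obj C Z"
    unfolding is_zero_obj_def using Z zro_hom by (intro conjI ballI ex1I) blast+
qed

lemma hom_from_zero: "is_zero_obj C Z \<Longrightarrow> f \<in> Hom C Z A \<Longrightarrow> f = Zro C Z A"
  using cmp_idn[of f Z A] cmp_zro[of f Z A Z] by (simp add: is_zero_obj_iff)

lemma hom_to_zero: "is_zero_obj C Z \<Longrightarrow> f \<in> Hom C A Z \<Longrightarrow> f = Zro C A Z"
  using idn_cmp[of f A Z] zro_cmp[of f A Z Z] by (simp add: is_zero_obj_iff)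

lemma zero_iso: "is_zero_obj C Z \<Longrightarrow> is_zero_obj C Y \<Longrightarrow> is_iso C (Zro C Z Y)"
  by (rule is_isoI[of _ Z Y "Zro C Y Z"]) (simp_all add: is_zero_obj_iff zro_hom zro_cmp[OF zro_hom])

lemma zero_isomorphic: "is_zero_obj C Z \<Longrightarrow> is_zero_obj C Y \<Longrightarrow> isomorphic C Z Y"
  using isomorphicI[OF zro_hom zero_iso] is_zero_obj_iff by blast

lemma mono_to_zero:
  assumes f: "f \<in> Hom C A Z" "is_mono C f" and Z: "is_zero_obj C Z"
  shows "is_zero_obj C A"
proof -
  have "f \<diamond> Idn C A = Zro C A Z" using hom_to_zero[OF Z f(1)] cmp_idn[OF f(1)] by simp
  then have "Idn C A = Zro C A A" using mono_zroD[OF f(2,1) idn_hom] HomD[OF f(1)] by blast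
  then show ?thesis using HomD[OF f(1)] is_zero_obj_iff by blast
qed

lemma zero_obj_isomorphic:
  assumes Z: "is_zero_obj C Z" and "isomorphic C Z A"
  shows "is_zero_obj C A"
proof -
  obtain h where "h \<in> Hom C A Z" "is_iso C h"
    using isomorphic_sym[OF assms(2)] by (auto simp: isomorphic_def)
  then show ?thesis using mono_to_zero iso_is_mono Z by blast
qed

lemma zero_obj_isoclass:
  assumes "is_zero_obj C Z"
  shows "isoclass C Z = {Z. is_zero_obj C Z}"
  using assms zero_isomorphic zero_obj_isomorphic is_zero_obj_iff unfolding isoclass_def by blast

text \<open>The cokernel arrow \<open>c\<close> kills an epimorphism, so \<open>c\<close> is zero;
  being epi itself, it forces the identity of its target to be zero.\<close>

lemma epi_coker_obj_zero:
  assumes h: "is_epi C h" "h \<in> Hom C A B" and D: "is_coker_obj C h D"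
  shows "is_zero_obj C D"
proof -
  obtain c where c: "is_cokernel C c h" "isomorphic C (Tgt C c) D"
    using D by (auto simp: is_coker_obj_def)
  have c1: "c \<in> Hom C B (Tgt C c)" by (rule is_cokernelD[OF c(1) h(2)])
  have "c = Zro C B (Tgt C c)" using epi_zroD[OF h c1] is_cokernelD[OF c(1) h(2)] by blast
  then have "Idn C (Tgt C c) \<diamond> c = Zro C B (Tgt C c)" using idn_cmp[OF c1] by simp
  then have "Idn C (Tgt C c) = Zro C (Tgt C c) (Tgt C c)"
    using epi_zroD[OF cokernel_is_epi[OF c(1) h(2)] c1 idn_hom] HomD[OF c1] by simp
  then show ?thesis using c(2) zero_obj_isomorphic HomD[OF c1] is_zero_obj_iff by metis
qed

text \<open>The identity of \<open>V\<close> kills the zero arrow when composed after it, so it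
  factors as \<open>d \<diamond> c\<close>. As \<open>c\<close> is epi, this one-sided inverse is
  two-sided.\<close>

lemma zro_coker_obj:
  assumes "is_cokernel C c (Zro C Z V)" "Z \<in> Obj C" "V \<in> Obj C"
  shows "isomorphic C V (Tgt C c)"
proof -
  let ?z = "Zro C Z V"
  have z: "?z \<in> Hom C Z V" using assms zro_hom by blast
  have c: "c \<in> Hom C V (Tgt C c)" by (rule is_cokernelD[OF assms(1) z])
  have "Idn C V \<diamond> ?z = ?z" using idn_cmp[OF z] .
  then obtain d where d: "d \<in> Hom C (Tgt C c) V" "d \<diamond> c = Idn C V"
    using is_cokernelD(3)[OF assms(1) z idn_hom[OF assms(3)]] by blast
  have "(c \<diamond> d) \<diamond> c = Idn C (Tgt C c) \<diamond> c"
    using cmp_assoc[OF c d(1) c] d(2) cmp_idn[OF c] idn_cmp[OF c] by simp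
  then have "c \<diamond> d = Idn C (Tgt C c)"
    using is_epiD[OF cokernel_is_epi[OF assms(1) z] c cmp_hom[OF d(1) c]] idn_hom HomD[OF c] by blast
  then show ?thesis using is_isoI[OF c d(1,2)] c isomorphicI by blast
qed

section \<open>Direct sums and powers of simple objects\<close>

lemma direct_sum_0:
  assumes "is_direct_sum C 0 A D inc prj"
  shows "is_zero_obj C D"
proof -
  have D: "D \<in> Obj C" using assms by (simp add: is_direct_sum_def)
  interpret comm_group "hom_group C D D" by (rule hom_group[OF D D])
  have "Idn C D = \<one>\<^bsub>hom_group C D D\<^esub>" using assms by (simp add: is_direct_sum_def)
  then show ?thesis using D is_zero_obj_iff by (simp add: hom_group_def)
qed

lemma direct_sum_1:
  assumes "is_direct_sum C 1 A D inc prj"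
  shows "inc 0 \<diamond> prj 0 = Idn C D"
proof -
  have D: "D \<in> Obj C" and *: "inc 0 \<in> Hom C (A 0) D" "prj 0 \<in> Hom C D (A 0)"
    using assms by (auto simp: is_direct_sum_def)
  interpret comm_group "hom_group C D D" by (rule hom_group[OF D D])
  have "inc 0 \<diamond> prj 0 \<in> carrier (hom_group C D D)"
    using cmp_hom[OF *(2,1)] by (simp add: hom_group_def)
  then have "finprod (hom_group C D D) (\<lambda>j. inc j \<diamond> prj j) {..<1} = inc 0 \<diamond> prj 0"
    by (simp add: lessThan_Suc)
  then show ?thesis using assms by (simp add: is_direct_sum_def)
qed

lemma direct_sum_2:
  assumes "is_direct_sum C 2 A D inc prj"
  shows "Pls C (inc 1 \<diamond> prj 1) (inc 0 \<diamond> prj 0) = Idn C D"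
proof -
  have D: "D \<in> Obj C" and *: "\<And>j. j < 2 \<Longrightarrow> inc j \<in> Hom C (A j) D" "\<And>j. j < 2 \<Longrightarrow> prj j \<in> Hom C D (A j)"
    using assms by (auto simp: is_direct_sum_def)
  interpret comm_group "hom_group C D D" by (rule hom_group[OF D D])
  have *: "inc j \<diamond> prj j \<in> carrier (hom_group C D D)" if "j < 2" for j
    using cmp_hom[OF *(2,1)] that by (simp add: hom_group_def)
  have "{..<2::nat} = insert 1 {0}" by auto
  then have "finprod (hom_group C D D) (\<lambda>j. inc j \<diamond> prj j) {..<2}
      = (inc 1 \<diamond> prj 1) \<otimes>\<^bsub>hom_group C D D\<^esub> (inc 0 \<diamond> prj 0)"
    using *[of 0] *[of 1] by (simp add: Pi_def)
  then show ?thesis using assms by (simp add: is_direct_sum_def hom_group_def)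
qed

text \<open>For \<open>n \<noteq> 0\<close> an injection embeds \<open>T\<close> in \<open>D\<close>
  as a split monomorphism, so \<open>D\<close> cannot be zero when \<open>T\<close> is not.\<close>

lemma power_zero_iff:
  assumes "is_power C n T D" "T \<in> Obj C" "\<not> is_zero_obj C T" 
  shows "is_zero_obj C D \<longleftrightarrow> n = 0"
proof -
  obtain inc prj where d: "is_direct_sum C n (\<lambda>_. T) D inc prj"
    using assms by (auto simp: is_power_def)
  show ?thesis
  proof
    assume D: "is_zero_obj C D"
    show "n = 0"
    proof (rule ccontr)
      assume "n \<noteq> 0"
      then have "inc 0 \<in> Hom C T D" "prj 0 \<in> Hom C D T" "prj 0 \<diamond> inc 0 = Idn C T"
        using d by (auto simp: is_direct_sum_def)
      then show False using split_mono_is_mono mono_to_zero D assms(3) by metis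
    qed
  next
    assume "n = 0"
    then show "is_zero_obj C D" using d direct_sum_0 by blast
  qed
qed

lemma simple_isomorphic:
  assumes V: "is_simple C V" and iso: "isomorphic C V D"
  shows "is_simple C D"
proof -
  obtain h where h: "h \<in> Hom C D V" "is_iso C h"
    using isomorphic_sym[OF iso] by (auto simp: isomorphic_def)
  obtain g where g: "g \<in> Hom C V D" "is_iso C g" "g \<diamond> h = Idn C D" using is_isoE[OF h(2,1)] by metis
  have "\<not> is_zero_obj C D"
    using V iso isomorphic_sym zero_obj_isomorphic unfolding is_simple_def by blast
  moreover have "is_zero_obj C (Src C k) \<or> is_iso C k" if k: "is_mono C k" "Tgt C k = D" for k
  proof -
    have k1: "k \<in> Hom C (Src C k) D" using k by (auto simp: is_mono_def Hom_def)
    have hk: "h \<diamond> k \<in> Hom C (Src C k) V" by (rule cmp_hom[OF k1 h(1)])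
    moreover have "is_mono C (h \<diamond> k)"
      using mono_cmp[OF k1 k(1) h(1) iso_is_mono[OF h(2,1)]] .
    ultimately have "is_zero_obj C (Src C k) \<or> is_iso C (h \<diamond> k)"
      using V HomD[OF hk] unfolding is_simple_def by metis
    moreover have "k = g \<diamond> h \<diamond> k" using cmp_assoc[OF k1 h(1) g(1)] g(3) idn_cmp[OF k1] by simp
    ultimately show ?thesis using iso_cmp[OF hk _ g(1,2)] by metis
  qed
  ultimately show ?thesis using HomD[OF h(1)] by (auto simp: is_simple_def)
qed

text \<open>The injection \<open>inc 0\<close> is a split mono from a nonzero object into a simple
  one, hence an isomorphism. A further summand is impossible: its projection vanishes on
  \<open>inc 0\<close>, so it would be zero, although it splits its own injection.\<close>

lemma simple_power:
  assumes "is_power C n T D" "T \<in> Obj C" "\<not> is_zero_obj C T" "is_simple C D"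
  shows "n = 1" "isomorphic C D T"
proof -
  obtain inc prj where d: "is_direct_sum C n (\<lambda>_. T) D inc prj"
    using assms by (auto simp: is_power_def)
  have n: "n \<noteq> 0" using power_zero_iff assms by (auto simp: is_simple_def)
  have i: "inc 0 \<in> Hom C T D" and p: "prj 0 \<in> Hom C D T" "prj 0 \<diamond> inc 0 = Idn C T"
    using n d by (auto simp: is_direct_sum_def)
  have iso: "is_iso C (inc 0)"
    using assms(3,4) split_mono_is_mono[OF i p] HomD[OF i] unfolding is_simple_def by metis
  then show "isomorphic C D T" using i isomorphicI isomorphic_sym by blast
  show "n = 1"
  proof (rule ccontr)
    assume "n \<noteq> 1"
    with n have "1 < n" by simp
    then have i1: "inc 1 \<in> Hom C T D" and p1: "prj 1 \<in> Hom C D T" "prj 1 \<diamond> inc 1 = Idn C T"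
      and z: "prj 1 \<diamond> inc 0 = Zro C T T"
      using d n unfolding is_direct_sum_def by auto
    have "prj 1 = Zro C D T" using epi_zroD[OF iso_is_epi[OF iso i] i p1(1) z] .
    then have "Idn C T = Zro C T T" using zro_cmp[OF i1 assms(2)] p1(2) by simp
    then show False using assms(2,3) is_zero_obj_iff by blast
  qed
qed

end

section \<open>Extensions in abelian categories\<close>

context abelian_category
begin

text \<open>A mono \<open>k\<close> is the kernel of some \<open>g\<close> by normality. This
  \<open>g\<close> factors through the cokernel \<open>c\<close>, so whatever \<open>c\<close> kills
  is killed by \<open>g\<close> and lifts through \<open>k\<close>.\<close>

lemma kernel_of_cokernel:
  assumes k: "k \<in> Hom C K A" "is_mono C k" and c: "is_cokernel C c k"
  shows "is_kernel C k c"
proof -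
  obtain g where g: "is_kernel C k g" using normal_mono[OF k(2)] by blast
  have g1: "g \<in> Hom C A (Tgt C g)" using g k by (auto simp: is_kernel_def Hom_def)
  have c1: "c \<in> Hom C A (Tgt C c)" "c \<diamond> k = Zro C K (Tgt C c)" using is_cokernelD[OF c k(1)] by auto
  have gk: "g \<diamond> k = Zro C K (Tgt C g)" using is_kernelD(2)[OF g g1] HomD[OF k(1)] by simp
  obtain d where d: "d \<in> Hom C (Tgt C c) (Tgt C g)" "d \<diamond> c = g"
    using is_cokernelD(3)[OF c k(1) g1 gk] by blast
  show ?thesis
  proof (rule is_kernelI[OF k(1) c1(1) k(2) c1(2)])
    fix Y x assume x: "x \<in> Hom C Y A" and "c \<diamond> x = Zro C Y (Tgt C c)"
    then have "g \<diamond> x = Zro C Y (Tgt C g)"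
      using cmp_assoc[OF x c1(1) d(1)] d(2) cmp_zro[OF d(1)] HomD[OF x] by simp
    then show "\<exists>h. h \<in> Hom C Y K \<and> k \<diamond> h = x"
      using is_kernelD(3)[OF g g1 x] HomD[OF k(1)] by auto
  qed
qed

lemma cokernel_of_kernel:
  assumes c: "c \<in> Hom C A B" "is_epi C c" and k: "is_kernel C k c"
  shows "is_cokernel C c k"
proof -
  obtain g where g: "is_cokernel C c g" using normal_epi[OF c(2)] by blast
  have g1: "g \<in> Hom C (Src C g) A" using g c by (auto simp: is_cokernel_def Hom_def)
  have k1: "k \<in> Hom C (Src C k) A" "c \<diamond> k = Zro C (Src C k) B" using is_kernelD[OF k c(1)] by auto
  have cg: "c \<diamond> g = Zro C (Src C g) B" using is_cokernelD(2)[OF g g1] HomD[OF c(1)] by simp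
  obtain d where d: "d \<in> Hom C (Src C g) (Src C k)" "k \<diamond> d = g"
    using is_kernelD(3)[OF k c(1) g1 cg] by blast
  show ?thesis
  proof (rule is_cokernelI[OF c(1) k1(1) c(2) k1(2)])
    fix Y x assume x: "x \<in> Hom C A Y" and "x \<diamond> k = Zro C (Src C k) Y"
    then have "x \<diamond> g = Zro C (Src C g) Y"
      using cmp_assoc[OF d(1) k1(1) x] d(2) zro_cmp[OF d(1)] HomD[OF x] by simp
    then show "\<exists>h. h \<in> Hom C B Y \<and> h \<diamond> c = x"
      using is_cokernelD(3)[OF g g1 x] HomD[OF c(1)] by auto
  qed
qed

text \<open>By normality \<open>f\<close> is the kernel of some \<open>g\<close>, and
  \<open>g\<close> is zero because \<open>f\<close> is epi. Hence the identity of \<open>B\<close>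
  factors through \<open>f\<close>.\<close>

lemma mono_epi_iso:
  assumes f: "f \<in> Hom C A B" "is_mono C f" "is_epi C f"
  shows "is_iso C f"
proof -
  obtain g where g: "is_kernel C f g" using normal_mono[OF f(2)] by blast
  have g1: "g \<in> Hom C B (Tgt C g)" using g f by (auto simp: is_kernel_def Hom_def)
  have B: "B \<in> Obj C" using HomD[OF f(1)] by simp
  have "g \<diamond> f = Zro C A (Tgt C g)" using is_kernelD(2)[OF g g1] HomD[OF f(1)] by simp
  then have "g = Zro C B (Tgt C g)" by (rule epi_zroD[OF f(3,1) g1])
  then have "g \<diamond> Idn C B = Zro C B (Tgt C g)" using cmp_idn[OF g1] by simp
  then obtain h where h: "h \<in> Hom C B A" "f \<diamond> h = Idn C B"
    using is_kernelD(3)[OF g g1 idn_hom[OF B]] HomD[OF f(1)] by auto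
  have "f \<diamond> h \<diamond> f = f \<diamond> Idn C A"
    using cmp_assoc[OF f(1) h(1) f(1)] h(2) idn_cmp[OF f(1)] cmp_idn[OF f(1)] by simp
  then have "h \<diamond> f = Idn C A"
    using is_monoD[OF f(2,1) cmp_hom[OF f(1) h(1)] idn_hom] HomD[OF f(1)] by blast
  then show ?thesis using is_isoI[OF f(1) h(1)] h(2) by blast
qed

text \<open>The five lemma with identities at both ends. An arrow killed by \<open>h\<close> is
  killed by \<open>g\<close>, so it lifts to \<open>V\<close>, where the mono \<open>f'\<close>
  kills the lift. The epi half is dual and uses that \<open>g'\<close> is a cokernel of
  \<open>f'\<close>.\<close>

lemma short_five:
  assumes f: "f \<in> Hom C V E" "is_kernel C f g" and g: "g \<in> Hom C E U" "is_epi C g"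
    and f': "f' \<in> Hom C V E'" "is_kernel C f' g'" and g': "g' \<in> Hom C E' U" "is_epi C g'"
    and h: "h \<in> Hom C E E'" and hf: "h \<diamond> f = f'" and gh: "g' \<diamond> h = g"
  shows "is_iso C h"
proof (rule mono_epi_iso[OF h])
  show "is_mono C h"
  proof (rule mono_zroI[OF h])
    fix Y x assume x: "x \<in> Hom C Y E" and hx: "h \<diamond> x = Zro C Y E'"
    have Y: "Y \<in> Obj C" using HomD[OF x] by simp
    have "g \<diamond> x = Zro C Y U" using cmp_assoc[OF x h g'(1)] gh hx cmp_zro[OF g'(1) Y] by simp
    then obtain y where y: "y \<in> Hom C Y V" "f \<diamond> y = x"
      using is_kernelD(3)[OF f(2) g(1) x] HomD[OF f(1)] by auto
    have "f' \<diamond> y = Zro C Y E'" using cmp_assoc[OF y(1) f(1) h] hf hx y(2) by simp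
    then have "y = Zro C Y V" using mono_zroD[OF kernel_is_mono[OF f'(2) g'(1)] f'(1) y(1)] by blast
    then show "x = Zro C Y E" using y(2) cmp_zro[OF f(1) Y] by simp
  qed
  show "is_epi C h"
  proof (rule epi_zroI[OF h])
    fix Y x assume x: "x \<in> Hom C E' Y" and xh: "x \<diamond> h = Zro C E Y"
    have Y: "Y \<in> Obj C" using HomD[OF x] by simp
    have "x \<diamond> f' = Zro C V Y" using cmp_assoc[OF f(1) h x] hf xh zro_cmp[OF f(1) Y] by simp
    then obtain y where y: "y \<in> Hom C U Y" "y \<diamond> g' = x"
      using is_cokernelD(3)[OF cokernel_of_kernel[OF g' f'(2)] f'(1) x] HomD[OF g'(1)] by auto
    have "y \<diamond> g = Zro C E Y" using cmp_assoc[OF h g'(1) y(1)] gh xh y(2) by simp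
    then have "y = Zro C U Y" using epi_zroD[OF g(2,1) y(1)] by blast
    then show "x = Zro C E' Y" using y(2) zro_cmp[OF g'(1) Y] by simp
  qed
qed

text \<open>Exactness only gives \<open>f = k \<diamond> e\<close> with \<open>k\<close> a kernel of
  \<open>g\<close> and \<open>e\<close> epi. Since \<open>f\<close> is mono, so is \<open>e\<close>;
  thus \<open>e\<close> is an isomorphism and \<open>f\<close> is itself a kernel of
  \<open>g\<close>.\<close>

lemma extensions_1D:
  assumes "fs \<in> extensions C 1 U V"
  obtains f g E where "fs = [f, g]" "f \<in> Hom C V E" "g \<in> Hom C E U" "is_kernel C f g" "is_epi C g"
proof -
  obtain f g where fs: "fs = [f, g]"
    using assms by (auto simp: extensions_def length_Suc_conv)
  then have *: "f \<in> Arr C" "g \<in> Arr C" "Src C f = V" "Tgt C g = U" "is_mono C f" "is_epi C g" "exact_at C f g"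
    using assms by (auto simp: extensions_def)
  then obtain k e where k: "is_kernel C k g" "is_epi C e" "Tgt C e = Src C k" "f = k \<diamond> e"
    by (auto simp: exact_at_def)
  have g: "g \<in> Hom C (Src C g) U" using * by (simp add: Hom_def)
  have k1: "k \<in> Hom C (Src C k) (Src C g)" by (rule is_kernelD[OF k(1) g])
  have e0: "e \<in> Hom C (Src C e) (Src C k)" using k by (simp add: is_epi_def Hom_def)
  have f0: "f \<in> Hom C (Src C e) (Src C g)" using cmp_hom[OF e0 k1] k(4) by simp
  then have f: "f \<in> Hom C V (Src C g)" and e: "e \<in> Hom C V (Src C k)"
    using * e0 HomD[OF f0] by auto
  have "is_iso C e" using mono_epi_iso[OF e] mono_cancel[OF e k1] k * by simp
  then obtain i where i: "i \<in> Hom C (Src C k) V" "e \<diamond> i = Idn C (Src C k)"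
    using is_isoE[OF _ e] by metis
  have U: "U \<in> Obj C" using HomD[OF g] by simp
  have "is_kernel C f g"
  proof (rule is_kernelI[OF f g \<open>is_mono C f\<close>])
    show "g \<diamond> f = Zro C V U"
      using cmp_assoc[OF e k1 g] is_kernelD(2)[OF k(1) g] zro_cmp[OF e U] k(4) by simp
  next
    fix Y x assume x: "x \<in> Hom C Y (Src C g)" "g \<diamond> x = Zro C Y U"
    obtain y where y: "y \<in> Hom C Y (Src C k)" "k \<diamond> y = x" using is_kernelD(3)[OF k(1) g x] by blast
    have "f \<diamond> i \<diamond> y = x"
      using cmp_assoc[OF cmp_hom[OF y(1) i(1)] e k1] cmp_assoc[OF y(1) i(1) e] i(2) idn_cmp[OF y(1)] y(2) k(4)
      by simp
    then show "\<exists>h. h \<in> Hom C Y V \<and> f \<diamond> h = x" using cmp_hom[OF y(1) i(1)] by blast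
  qed
  then show thesis using that fs f g * by blast
qed

lemma extensions_1I:
  assumes f: "f \<in> Hom C V E" and g: "g \<in> Hom C E U" "is_epi C g" and k: "is_kernel C f g"
  shows "[f, g] \<in> extensions C 1 U V"
proof -
  have V: "V \<in> Obj C" using HomD[OF f] by simp
  have "exact_at C f g" unfolding exact_at_def
    using k iso_is_epi[OF idn_iso[OF V] idn_hom[OF V]] HomD[OF idn_hom[OF V]] HomD[OF f] cmp_idn[OF f]
    by (intro exI[of _ f] exI[of _ "Idn C V"]) simp
  then show ?thesis
    using kernel_is_mono[OF k g(1)] g(2) HomD[OF f] HomD[OF g(1)] by (simp add: extensions_def)
qed

text \<open>\<open>Tgt C (hd fs)\<close> is the middle term of the extension. A morphism that is the
  identity on both ends is an isomorphism in the middle by the short five lemma.\<close>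

lemma ext_step_1_isomorphic:
  assumes "(fs, gs) \<in> ext_step C 1 U V"
  shows "isomorphic C (Tgt C (hd fs)) (Tgt C (hd gs))"
proof -
  have "fs \<in> extensions C 1 U V" "gs \<in> extensions C 1 U V" using assms by (auto simp: ext_step_def)
  then obtain f g E f' g' E' where
    fs: "fs = [f, g]" "f \<in> Hom C V E" "g \<in> Hom C E U" "is_kernel C f g" "is_epi C g" and
    gs: "gs = [f', g']" "f' \<in> Hom C V E'" "g' \<in> Hom C E' U" "is_kernel C f' g'" "is_epi C g'"
    using extensions_1D by metis
  obtain h where h: "h 0 = Idn C V" "h (Suc 1) = Idn C U"
    "\<And>j. j \<le> 1 \<Longrightarrow> h j \<in> Hom C (Src C (fs ! j)) (Src C (gs ! j)) \<and> gs ! j \<diamond> h j = h (Suc j) \<diamond> fs ! j"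
    using assms by (auto simp: ext_step_def)
  have h1: "h 1 \<in> Hom C E E'" and "g' \<diamond> h 1 = g" "h 1 \<diamond> f = f'"
    using h(1,2) h(3)[of 0] h(3)[of 1] fs(1) gs(1) HomD[OF fs(3)] HomD[OF gs(3)]
      cmp_idn[OF gs(2)] idn_cmp[OF fs(3)] by auto
  then have "is_iso C (h 1)" using short_five[OF fs(2,4,3,5) gs(2,4,3,5)] by blast
  then show ?thesis using h1 fs gs isomorphicI HomD(3)[OF fs(2)] HomD(3)[OF gs(2)] by auto
qed

lemma ext_equiv_1_isomorphic:
  assumes "fs \<in> extensions C 1 U V" and "(fs, gs) \<in> (ext_step C 1 U V \<union> (ext_step C 1 U V)\<inverse>)\<^sup>*"
  shows "isomorphic C (Tgt C (hd fs)) (Tgt C (hd gs))"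
  using assms(2)
proof (induction rule: rtrancl_induct)
  case base
  obtain f g E where "fs = [f, g]" "f \<in> Hom C V E" using extensions_1D[OF assms(1)] by metis
  then show ?case using isomorphic_refl tgt_obj HomD by simp
next
  case (step gs hs)
  have "isomorphic C (Tgt C (hd gs)) (Tgt C (hd hs))"
    using step(2) ext_step_1_isomorphic isomorphic_sym by blast
  then show ?case using step(3) isomorphic_trans by blast
qed

text \<open>A member of a Hall set has subobject \<open>W\<close> and quotient \<open>U\<close> only
  up to isomorphism, while an extension must have exactly these end terms. Composing with
  \<open>i\<close> and \<open>j\<close> repairs both ends and leaves the middle term
  \<open>V\<close> untouched.\<close>

lemma Hall_set_extension:
  assumes V: "V \<in> Obj C" and "Hall_set C U W V \<noteq> {}"
  obtains fs where "fs \<in> extensions C 1 U W" "Tgt C (hd fs) = V"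
proof -
  obtain R k c where R: "R \<in> Subobjects C V" "k \<in> R" and W: "isomorphic C (Src C k) W"
    and c: "is_cokernel C c k" and U: "isomorphic C (Tgt C c) U"
    using assms(2) by (auto simp: Hall_set_def is_coker_obj_def)
  have k: "is_mono C k" "k \<in> Hom C (Src C k) V" using SubobjectsD[OF R] by auto
  have c1: "c \<in> Hom C V (Tgt C c)" "c \<diamond> k = Zro C (Src C k) (Tgt C c)" using is_cokernelD[OF c k(2)] by auto
  obtain i where i: "i \<in> Hom C W (Src C k)" "is_iso C i"
    using isomorphic_sym[OF W] by (auto simp: isomorphic_def)
  obtain i' where i': "i' \<in> Hom C (Src C k) W" "i \<diamond> i' = Idn C (Src C k)"
    using is_isoE[OF i(2,1)] by metis
  obtain j where j: "j \<in> Hom C (Tgt C c) U" "is_iso C j"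
    using U by (auto simp: isomorphic_def)
  have ki: "k \<diamond> i \<in> Hom C W V" and jc: "j \<diamond> c \<in> Hom C V U"
    using cmp_hom i k j c1 by blast+
  have Wo: "W \<in> Obj C" "U \<in> Obj C" using HomD[OF i(1)] HomD[OF j(1)] by auto
  have "is_kernel C (k \<diamond> i) (j \<diamond> c)"
  proof (rule is_kernelI[OF ki jc mono_cmp[OF i(1) iso_is_mono[OF i(2,1)] k(2,1)]])
    have "(j \<diamond> c) \<diamond> k \<diamond> i = j \<diamond> (c \<diamond> k) \<diamond> i"
      using cmp_assoc[OF ki c1(1) j(1)] cmp_assoc[OF i(1) k(2) c1(1)] by simp
    then show "(j \<diamond> c) \<diamond> k \<diamond> i = Zro C W U"
      using c1(2) zro_cmp[OF i(1)] cmp_zro[OF j(1)] HomD[OF c1(1)] Wo by simp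
  next
    fix Y x assume x: "x \<in> Hom C Y V" "(j \<diamond> c) \<diamond> x = Zro C Y U"
    have "j \<diamond> c \<diamond> x = Zro C Y U" using x(2) cmp_assoc[OF x(1) c1(1) j(1)] by simp
    then have "c \<diamond> x = Zro C Y (Tgt C c)"
      by (rule mono_zroD[OF iso_is_mono[OF j(2,1)] j(1) cmp_hom[OF x(1) c1(1)]])
    then obtain y where y: "y \<in> Hom C Y (Src C k)" "k \<diamond> y = x"
      using is_kernelD(3)[OF kernel_of_cokernel[OF k(2,1) c] c1(1) x(1)] by blast
    have "(k \<diamond> i) \<diamond> i' \<diamond> y = x"
      using cmp_assoc[OF cmp_hom[OF y(1) i'(1)] i(1) k(2)] cmp_assoc[OF y(1) i'(1) i(1)] i'(2) idn_cmp[OF y(1)] y(2)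
      by simp
    then show "\<exists>h. h \<in> Hom C Y W \<and> (k \<diamond> i) \<diamond> h = x" using cmp_hom[OF y(1) i'(1)] by blast
  qed
  then have "[k \<diamond> i, j \<diamond> c] \<in> extensions C 1 U W"
    by (rule extensions_1I[OF ki jc epi_cmp[OF c1(1) cokernel_is_epi[OF c k(2)] j(1) iso_is_epi[OF j(2,1)]]])
  then show thesis by (rule that) (simp add: HomD(3)[OF ki])
qed

text \<open>The isomorphism class of the middle term is an invariant of an extension, so there are at most
  \<open>|Ext\<^sup>1(U, W)|\<close> of them.\<close>

lemma finite_Hall_products:
  assumes "finite (Ext C 1 U W)"
  shows "finite {v \<in> Isoclasses C. Hall_set C U W (rep v) \<noteq> {}}" (is "finite ?M")
proof -
  let ?R = "(ext_step C 1 U W \<union> (ext_step C 1 U W)\<inverse>)\<^sup>*"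
  have "\<forall>v\<in>?M. \<exists>fs. fs \<in> extensions C 1 U W \<and> Tgt C (hd fs) = rep v"
  proof
    fix v assume "v \<in> ?M"
    then have "rep v \<in> Obj C" "Hall_set C U W (rep v) \<noteq> {}" using rep_isoclass(1) by auto
    then obtain fs where "fs \<in> extensions C 1 U W" "Tgt C (hd fs) = rep v" by (rule Hall_set_extension)
    then show "\<exists>fs. fs \<in> extensions C 1 U W \<and> Tgt C (hd fs) = rep v" by blast
  qed
  from bchoice[OF this] obtain e
    where e: "\<And>v. v \<in> ?M \<Longrightarrow> e v \<in> extensions C 1 U W \<and> Tgt C (hd (e v)) = rep v" by blast
  have "inj_on (\<lambda>v. ?R `` {e v}) ?M"
  proof (rule inj_onI)
    fix v w assume v: "v \<in> ?M" and w: "w \<in> ?M" and eq: "?R `` {e v} = ?R `` {e w}"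
    have "e w \<in> ?R `` {e v}" unfolding eq by (rule ImageI[OF rtrancl_refl]) (rule singletonI)
    then have "(e v, e w) \<in> ?R" by (rule Image_singleton_iff[THEN iffD1])
    then have "isomorphic C (rep v) (rep w)"
      using ext_equiv_1_isomorphic[of "e v" U W "e w"] e[OF v] e[OF w] by simp
    then have "isoclass C (rep v) = isoclass C (rep w)"
      using rep_isoclass(1)[of v] rep_isoclass(1)[of w] v w by (simp add: isoclass_eq_iff)
    then show "v = w" using rep_isoclass(2)[of v] rep_isoclass(2)[of w] v w by simp
  qed
  moreover have "(\<lambda>v. ?R `` {e v}) ` ?M \<subseteq> Ext C 1 U W"
    unfolding Ext_def using e quotientI[of _ "extensions C 1 U W" ?R] by (simp add: image_subset_iff)
  ultimately show ?thesis using assms by (rule inj_on_finite)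
qed

text \<open>Serves to make \<open>Ext C 1 U V\<close> nonempty; the witness is the biproduct with
  its injection of \<open>V\<close> and projection onto \<open>U\<close>.\<close>

lemma split_extension:
  assumes "U \<in> Obj C" "V \<in> Obj C"
  shows "extensions C 1 U V \<noteq> {}"
proof -
  have "\<exists>D inc prj. is_direct_sum C 2 (\<lambda>j. if j = 0 then V else U) D inc prj"
    by (rule direct_sums) (simp add: assms)
  then obtain D inc prj where d: "is_direct_sum C 2 (\<lambda>j. if j = 0 then V else U) D inc prj" by blast
  have i: "inc 0 \<in> Hom C V D" "inc 1 \<in> Hom C U D" and p: "prj 0 \<in> Hom C D V" "prj 1 \<in> Hom C D U"
    and pi: "prj 0 \<diamond> inc 0 = Idn C V" "prj 1 \<diamond> inc 1 = Idn C U" "prj 1 \<diamond> inc 0 = Zro C V U"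
  proof -
    have "inc j \<in> Hom C (if j = 0 then V else U) D" "prj j \<in> Hom C D (if j = 0 then V else U)"
      "prj j \<diamond> inc j = Idn C (if j = 0 then V else U)" if "j < 2" for j
      using d that unfolding is_direct_sum_def by simp_all
    from this[of 0] this[of 1] show "inc 0 \<in> Hom C V D" "inc 1 \<in> Hom C U D"
      "prj 0 \<in> Hom C D V" "prj 1 \<in> Hom C D U" "prj 0 \<diamond> inc 0 = Idn C V" "prj 1 \<diamond> inc 1 = Idn C U" by simp_all
    have "prj l \<diamond> inc j = Zro C (if j = 0 then V else U) (if l = 0 then V else U)" if "j < 2" "l < 2" "j \<noteq> l" for j l
      using d that unfolding is_direct_sum_def by simp
    from this[of 0 1] show "prj 1 \<diamond> inc 0 = Zro C V U" by simp
  qed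
  have D: "D \<in> Obj C" using HomD[OF i(1)] by simp
  have "is_kernel C (inc 0) (prj 1)"
  proof (rule is_kernelI[OF i(1) p(2) split_mono_is_mono[OF i(1) p(1) pi(1)] pi(3)])
    fix Y x assume x: "x \<in> Hom C Y D" "prj 1 \<diamond> x = Zro C Y U"
    have px: "prj 0 \<diamond> x \<in> Hom C Y V" by (rule cmp_hom[OF x(1) p(1)])
    \<comment> \<open>Decomposing the identity of \<open>D\<close> splits \<open>x\<close> into its
      two components; the one through \<open>U\<close> vanishes, so \<open>x\<close> is recovered
      from its component in \<open>V\<close>.\<close>
    have "x = Pls C (inc 1 \<diamond> prj 1) (inc 0 \<diamond> prj 0) \<diamond> x"
      using direct_sum_2[OF d] idn_cmp[OF x(1)] by simp
    also have "\<dots> = Pls C (inc 1 \<diamond> prj 1 \<diamond> x) (inc 0 \<diamond> prj 0 \<diamond> x)"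
      using cmp_pls_left[OF x(1) cmp_hom[OF p(2) i(2)] cmp_hom[OF p(1) i(1)]]
        cmp_assoc[OF x(1) p(1) i(1)] cmp_assoc[OF x(1) p(2) i(2)] by simp
    also have "\<dots> = inc 0 \<diamond> prj 0 \<diamond> x"
      using x(2) cmp_zro[OF i(2)] HomD[OF x(1)] pls_zro[OF cmp_hom[OF px i(1)]] by simp
    finally show "\<exists>h. h \<in> Hom C Y V \<and> inc 0 \<diamond> h = x" using px by metis
  qed
  then show ?thesis using extensions_1I[OF i(1) p(2) split_epi_is_epi[OF p(2) i(2) pi(2)]] by blast
qed

text \<open>Every factor is a real power of a positive cardinality: finiteness comes from
  \<open>finitary\<close>, and nonemptiness from the zero arrow in degree 0, the split extension in
  degree 1 and the singleton in higher degrees.\<close>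

lemma euler_pos:
  assumes "finitary C" "hereditary C" "U \<in> Obj C" "V \<in> Obj C"
  shows "euler C U V > 0"
proof -
  have "card (Ext C n U V) > 0" for n
  proof -
    consider "n = 0" | "n = 1" | "n \<ge> 2" by linarith
    then have "Ext C n U V \<noteq> {}"
    proof cases
      case 1
      then show ?thesis using zro_hom assms(3,4) by (auto simp: Ext_def)
    next
      case 2
      then show ?thesis using split_extension[OF assms(3,4)] by (auto simp: Ext_def quotient_def)
    next
      case 3
      then show ?thesis using assms unfolding hereditary_def Ext_vanishes_def by blast
    qed
    then show ?thesis using assms unfolding finitary_def by (simp add: card_gt_0_iff)
  qed
  then show ?thesis unfolding euler_def Prod_any.expand_set by (intro prod_pos) simp
qed

end

section \<open>Flags of simple objects\<close>

context abelian_category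
begin

lemma idn_subobjectD:
  assumes "r \<in> subobject C (Idn C V)" "V \<in> Obj C"
  shows "is_iso C r" "r \<in> Hom C (Src C r) V"
proof -
  obtain h where h: "h \<in> Hom C (Src C r) V" "is_iso C h" "r = Idn C V \<diamond> h"
    using assms HomD[OF idn_hom[of V]] by (auto simp: subobject_def)
  moreover have "r = h" using h(3) idn_cmp[OF h(1)] by simp
  ultimately show "is_iso C r" "r \<in> Hom C (Src C r) V" by simp_all
qed

lemma zro_mono: "is_zero_obj C Z \<Longrightarrow> V \<in> Obj C \<Longrightarrow> is_mono C (Zro C Z V)"
  using mono_zroI[OF zro_hom] hom_to_zero is_zero_obj_iff by metis

lemma zro_subobjectD:
  assumes r: "r \<in> subobject C (Zro C Z V)" and Z: "is_zero_obj C Z" and V: "V \<in> Obj C"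
  shows "is_zero_obj C (Src C r)" "r \<in> Hom C (Src C r) V"
proof -
  have z: "Zro C Z V \<in> Hom C Z V" using Z V is_zero_obj_iff zro_hom by blast
  then obtain h where h: "h \<in> Hom C (Src C r) Z" "is_iso C h" "r = Zro C Z V \<diamond> h"
    using r HomD[OF z] by (auto simp: subobject_def)
  then show "r \<in> Hom C (Src C r) V" using cmp_hom[OF h(1) z] by simp
  show "is_zero_obj C (Src C r)" by (rule mono_to_zero[OF h(1) iso_is_mono[OF h(2,1)] Z])
qed

lemma subobject_of_iso:
  assumes R: "R \<in> Subobjects C V" "r \<in> R" and "is_iso C r"
  shows "R = subobject C (Idn C V)"
proof -
  have r: "r \<in> Hom C (Src C r) V" "is_mono C r" using SubobjectsD[OF R] by auto
  have V: "V \<in> Obj C" using HomD[OF r(1)] by simp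
  have "r \<in> subobject C (Idn C V)"
    unfolding subobject_def using r HomD[OF r(1)] assms(3) idn_cmp[OF r(1)] HomD[OF idn_hom[OF V]] by auto
  then show ?thesis using subobject_eq[OF idn_hom[OF V]] SubobjectsD(3)[OF R] by simp
qed

text \<open>The choice of zero object does not matter: the zero arrow between two zero objects is an
  isomorphism and is compatible with the arrows to \<open>V\<close>. Fixing one \<open>Z\<close>
  gives a canonical name to the bottom subobject.\<close>

lemma subobject_of_zero:
  assumes R: "R \<in> Subobjects C V" "r \<in> R" and "is_zero_obj C (Src C r)" and Z: "is_zero_obj C Z"
  shows "R = subobject C (Zro C Z V)"
proof -
  have r: "r \<in> Hom C (Src C r) V" "is_mono C r" using SubobjectsD[OF R] by auto
  have V: "V \<in> Obj C" using HomD[OF r(1)] by simp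
  have z: "Zro C Z V \<in> Hom C Z V" using Z V is_zero_obj_iff zro_hom by blast
  have zz: "Zro C (Src C r) Z \<in> Hom C (Src C r) Z" using assms is_zero_obj_iff zro_hom by blast
  have "r = Zro C Z V \<diamond> Zro C (Src C r) Z"
    using hom_from_zero[OF assms(3) r(1)] hom_from_zero[OF assms(3) cmp_hom[OF zz z]] by simp
  then have "r \<in> subobject C (Zro C Z V)"
    unfolding subobject_def mem_Collect_eq HomD(2,3)[OF z] HomD(3)[OF r(1)]
    using r(2) zero_iso[OF assms(3) Z] zz by blast
  then show ?thesis using subobject_eq[OF z] SubobjectsD(3)[OF R] by simp
qed

lemma Subobjects_simple:
  assumes V: "is_simple C V" and R: "R \<in> Subobjects C V" and Z: "is_zero_obj C Z"
  shows "R = subobject C (Idn C V) \<or> R = subobject C (Zro C Z V)"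
proof -
  obtain k where k: "is_mono C k" "Tgt C k = V" "R = subobject C k"
    using R by (auto simp: Subobjects_def)
  have "k \<in> Hom C (Src C k) V" using k(1,2) by (simp add: is_mono_def Hom_def)
  then have kR: "k \<in> R" unfolding k(3) by (rule subobject_self[OF k(1)])
  have "is_zero_obj C (Src C k) \<or> is_iso C k" using V k(1,2) unfolding is_simple_def by blast
  then show ?thesis using subobject_of_iso[OF R kR] subobject_of_zero[OF R kR _ Z] by blast
qed

text \<open>The condition that \<open>Flags\<close> imposes on two consecutive members, with
  \<open>R\<close> the larger one. Isolating it allows it to be evaluated on each pair formed from
  the top and bottom subobjects.\<close>

definition flag_step :: "nat \<Rightarrow> 'a \<Rightarrow> 'b set \<Rightarrow> 'b set \<Rightarrow> bool" where
  "flag_step n T R R' \<longleftrightarrow> (\<exists>r\<in>R. \<exists>r'\<in>R'. \<exists>h\<in>Hom C (Src C r') (Src C r).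
    r' = r \<diamond> h \<and> (\<exists>D. is_power C n T D \<and> is_coker_obj C h D))"

text \<open>A step that does not move is realised by an identity arrow, whose cokernel is zero, that
  is, the empty sum of copies of \<open>T\<close>.\<close>

lemma flag_step_refl:
  assumes "R \<in> Subobjects C V" "R \<noteq> {}" "T \<in> Obj C"
  shows "flag_step 0 T R R"
proof -
  obtain r where r: "r \<in> R" "r \<in> Hom C (Src C r) V" using assms SubobjectsD by blast
  have A: "Src C r \<in> Obj C" using HomD[OF r(2)] by simp
  have "\<exists>D inc prj. is_direct_sum C 0 (\<lambda>_. T) D inc prj" by (rule direct_sums) simp
  then obtain D where D: "is_power C 0 T D" "is_zero_obj C D"
    using direct_sum_0 unfolding is_power_def by blast
  obtain c where c: "is_cokernel C c (Idn C (Src C r))" using cokernels HomD[OF idn_hom[OF A]] by blast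
  have "Tgt C c \<in> Obj C" using is_cokernelD(1)[OF c idn_hom[OF A]] HomD by blast
  then have "is_coker_obj C (Idn C (Src C r)) (Tgt C c)"
    using c isomorphic_refl by (auto simp: is_coker_obj_def)
  then have "is_zero_obj C (Tgt C c)"
    by (rule epi_coker_obj_zero[OF iso_is_epi[OF idn_iso[OF A] idn_hom[OF A]] idn_hom[OF A]])
  then have "is_coker_obj C (Idn C (Src C r)) D"
    using c D(2) zero_isomorphic unfolding is_coker_obj_def by blast
  then show ?thesis unfolding flag_step_def
    using r D(1) idn_hom[OF A] cmp_idn[OF r(2)] by metis
qed

text \<open>Two members of one class differ by an isomorphism \<open>e\<close>. Since
  \<open>r\<close> is mono, the connecting arrow must be \<open>e\<close>, so its cokernel is zero
  and contains no copy of the nonzero object \<open>T\<close>.\<close>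

lemma flag_step_reflD:
  assumes R: "R \<in> Subobjects C V" and T: "T \<in> Obj C" "\<not> is_zero_obj C T" and s: "flag_step n T R R"
  shows "n = 0"
proof -
  obtain r r' h D where r: "r \<in> R" "r' \<in> R" and h: "h \<in> Hom C (Src C r') (Src C r)" "r' = r \<diamond> h"
    and D: "is_power C n T D" "is_coker_obj C h D"
    using s unfolding flag_step_def by blast
  have r1: "is_mono C r" "r \<in> Hom C (Src C r) V" "R = subobject C r" using SubobjectsD[OF R r(1)] by auto
  obtain e where e: "e \<in> Hom C (Src C r') (Src C r)" "is_iso C e" "r' = r \<diamond> e"
    using r(2) r1(3) unfolding subobject_def by auto
  then have "h = e" using is_monoD[OF r1(1,2) h(1) e(1)] h(2) by simp
  then have "is_zero_obj C D" using epi_coker_obj_zero[OF iso_is_epi[OF e(2,1)] e(1)] D by simp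
  then show ?thesis using power_zero_iff[OF D(1) T] by simp
qed

text \<open>The connecting arrow is mono by cancellation and ends in a zero object, so its source is
  zero: a flag that has reached 0 stays there.\<close>

lemma flag_step_zeroD:
  assumes Z: "is_zero_obj C Z" and V: "V \<in> Obj C" and R: "R \<in> Subobjects C V"
    and s: "flag_step n T (subobject C (Zro C Z V)) R"
  shows "R = subobject C (Zro C Z V)"
proof -
  obtain r r' h where r: "r \<in> subobject C (Zro C Z V)" "r' \<in> R" and h: "h \<in> Hom C (Src C r') (Src C r)" "r' = r \<diamond> h"
    using s unfolding flag_step_def by blast
  have r1: "r \<in> Hom C (Src C r) V" "is_zero_obj C (Src C r)" using zro_subobjectD[OF r(1) Z V] by auto
  have "is_mono C h" using mono_cancel[OF h(1) r1(1)] SubobjectsD[OF R r(2)] h(2) by simp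
  then have "is_zero_obj C (Src C r')" using mono_to_zero[OF h(1)] r1(2) by blast
  then show ?thesis using subobject_of_zero[OF R r(2) _ Z] by blast
qed

text \<open>The connecting arrow starts at a zero object, so its cokernel is all of
  \<open>V\<close>. The step thus says that the simple object \<open>V\<close> is a power of
  \<open>T\<close>, which \<open>simple_power\<close> allows only for one copy.\<close>

lemma flag_step_simple_zero:
  assumes Z: "is_zero_obj C Z" and V: "is_simple C V" and T: "T \<in> Obj C" "\<not> is_zero_obj C T"
  shows "flag_step n T (subobject C (Idn C V)) (subobject C (Zro C Z V)) \<longleftrightarrow> n = 1 \<and> isomorphic C V T"
proof
  have V1: "V \<in> Obj C" using V by (simp add: is_simple_def)
  assume "flag_step n T (subobject C (Idn C V)) (subobject C (Zro C Z V))"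
  then obtain r r' h D where r: "r \<in> subobject C (Idn C V)" "r' \<in> subobject C (Zro C Z V)"
    and h: "h \<in> Hom C (Src C r') (Src C r)" and D: "is_power C n T D" "is_coker_obj C h D"
    unfolding flag_step_def by blast
  have r1: "is_iso C r" "r \<in> Hom C (Src C r) V" using idn_subobjectD[OF r(1) V1] by auto
  have r': "is_zero_obj C (Src C r')" using zro_subobjectD[OF r(2) Z V1] by auto
  obtain c where c: "is_cokernel C c h" "isomorphic C (Tgt C c) D" using D by (auto simp: is_coker_obj_def)
  have "isomorphic C (Src C r) (Tgt C c)"
    using zro_coker_obj[of c "Src C r'" "Src C r"] hom_from_zero[OF r' h] c(1) HomD[OF h] by simp
  then have VD: "isomorphic C V D"
    using isomorphicI[OF r1(2,1)] c(2) isomorphic_sym isomorphic_trans by blast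
  show "n = 1 \<and> isomorphic C V T"
    using simple_power[OF D(1) T simple_isomorphic[OF V VD]] VD isomorphic_trans by blast
next
  have V1: "V \<in> Obj C" using V by (simp add: is_simple_def)
  have Z1: "Z \<in> Obj C" using Z is_zero_obj_iff by blast
  assume n: "n = 1 \<and> isomorphic C V T"
  have "\<exists>D inc prj. is_direct_sum C 1 (\<lambda>_. T) D inc prj" by (rule direct_sums) (rule T)
  then obtain D inc prj where D: "is_direct_sum C 1 (\<lambda>_. T) D inc prj" by blast
  have i: "inc 0 \<in> Hom C T D" "prj 0 \<in> Hom C D T" "prj 0 \<diamond> inc 0 = Idn C T"
    using D by (auto simp: is_direct_sum_def)
  have "isomorphic C T D" using isomorphicI[OF i(1) is_isoI[OF i direct_sum_1[OF D]]] .
  then have VD: "isomorphic C V D" using n isomorphic_trans by blast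
  have z: "Zro C Z V \<in> Hom C Z V" by (rule zro_hom[OF Z1 V1])
  obtain c where c: "is_cokernel C c (Zro C Z V)" using cokernels HomD[OF z] by blast
  have "is_coker_obj C (Zro C Z V) D"
    using c zro_coker_obj[OF c Z1 V1] VD isomorphic_sym isomorphic_trans unfolding is_coker_obj_def by blast
  moreover have "is_power C n T D" using D n by (auto simp: is_power_def)
  moreover have "Idn C V \<in> subobject C (Idn C V)" "Zro C Z V \<in> subobject C (Zro C Z V)"
    using subobject_self[OF iso_is_mono[OF idn_iso idn_hom] idn_hom] subobject_self[OF zro_mono[OF Z V1] z] V1
    by auto
  ultimately show "flag_step n T (subobject C (Idn C V)) (subobject C (Zro C Z V))"
    unfolding flag_step_def
    using z HomD[OF z] HomD[OF idn_hom[OF V1]] idn_cmp[OF z] by metis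
qed

lemma Flags_simple_iff:
  assumes V: "is_simple C V" and Z: "is_zero_obj C Z" and a: "a \<in> {1..m} \<rightarrow>\<^sub>E UNIV"
    and T: "\<And>k. k \<in> {1..m} \<Longrightarrow> T k \<in> Obj C" "\<And>k. k \<in> {1..m} \<Longrightarrow> \<not> is_zero_obj C (T k)"
  shows "F \<in> Flags C m T a V \<longleftrightarrow> (\<exists>k\<in>{1..m}. isomorphic C V (T k) \<and>
    a = (\<lambda>l\<in>{1..m}. if l = k then 1 else 0) \<and>
    F = (\<lambda>l\<in>{0..m}. if l < k then subobject C (Idn C V) else subobject C (Zro C Z V)))" (is "_ \<longleftrightarrow> ?rhs")
proof -
  let ?top = "subobject C (Idn C V)" and ?bot = "subobject C (Zro C Z V)"
  have V1: "V \<in> Obj C" "\<not> is_zero_obj C V" using V by (auto simp: is_simple_def)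
  have Z1: "Z \<in> Obj C" using Z is_zero_obj_iff by blast
  have top: "?top \<in> Subobjects C V" "Idn C V \<in> ?top"
    using subobject_in_Subobjects[OF iso_is_mono[OF idn_iso idn_hom] idn_hom]
      subobject_self[OF iso_is_mono[OF idn_iso idn_hom] idn_hom] V1 by simp_all
  have bot: "?bot \<in> Subobjects C V" "Zro C Z V \<in> ?bot"
    using subobject_in_Subobjects[OF zro_mono[OF Z V1(1)] zro_hom[OF Z1 V1(1)]]
      subobject_self[OF zro_mono[OF Z V1(1)] zro_hom[OF Z1 V1(1)]] by simp_all
  \<comment> \<open>Members of the bottom class have zero source, whereas the top class contains the
    identity of the nonzero object \<open>V\<close>.\<close>
  have ne: "?top \<noteq> ?bot"
  proof
    assume "?top = ?bot"
    then have "Idn C V \<in> ?bot" using top(2) by simp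
    then show False using zro_subobjectD(1)[OF _ Z V1(1)] V1(2) HomD(2)[OF idn_hom[OF V1(1)]] by metis
  qed
  have F_iff: "F \<in> Flags C m T a V \<longleftrightarrow> F \<in> {0..m} \<rightarrow>\<^sub>E Subobjects C V \<and> Idn C V \<in> F 0 \<and>
      (\<exists>r\<in>F m. is_zero_obj C (Src C r)) \<and> (\<forall>k\<in>{1..m}. flag_step (a k) (T k) (F (k - 1)) (F k))"
    unfolding Flags_def flag_step_def by blast
  show ?thesis
  proof
    assume "F \<in> Flags C m T a V"
    then have F: "F \<in> {0..m} \<rightarrow>\<^sub>E Subobjects C V" "Idn C V \<in> F 0" "\<exists>r\<in>F m. is_zero_obj C (Src C r)"
      and s: "\<And>k. k \<in> {1..m} \<Longrightarrow> flag_step (a k) (T k) (F (k - 1)) (F k)"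
      using F_iff by blast+
    have Fs: "F k \<in> Subobjects C V" if "k \<le> m" for k using F(1) that by (auto simp: PiE_def Pi_def)
    have F0: "F 0 = ?top" using subobject_of_iso[OF Fs F(2) idn_iso[OF V1(1)]] by simp
    have Fm: "F m = ?bot" using subobject_of_zero[OF Fs _ _ Z] F(3) by blast
    \<comment> \<open>The index of the jump. It exists and is at most \<open>m\<close> because the
      flag ends at the bottom, and it is positive because the flag starts at the top, so
      \<open>k - 1\<close> is a genuine predecessor.\<close>
    define k where "k = (LEAST i. F i = ?bot)"
    have k: "F k = ?bot" unfolding k_def using Fm by (rule LeastI)
    have km: "k \<le> m" unfolding k_def using Fm by (rule Least_le)
    have k0: "k \<noteq> 0" using F0 k ne by metis
    have lt: "F i = ?top" if "i < k" for i
      using not_less_Least[of i "\<lambda>i. F i = ?bot"] that km Subobjects_simple[OF V Fs Z, of i] unfolding k_def by simp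
    have ge: "F i = ?bot" if "k \<le> i" "i \<le> m" for i
      using that
    proof (induction i rule: dec_induct)
      case (step i)
      then have "flag_step (a (Suc i)) (T (Suc i)) ?bot (F (Suc i))" using s[of "Suc i"] by simp
      then show ?case using flag_step_zeroD[OF Z V1(1) Fs] step by blast
    qed (rule k)
    have kI: "k \<in> {1..m}" using k0 km by simp
    have "flag_step (a k) (T k) ?top ?bot" using s[OF kI] lt[of "k - 1"] k kI by simp
    then have ak: "a k = 1" "isomorphic C V (T k)"
      using flag_step_simple_zero[OF Z V T(1)[OF kI] T(2)[OF kI]] by auto
    have "a l = 0" if l: "l \<in> {1..m}" "l \<noteq> k" for l
    proof -
      have "F (l - 1) = F l"
      proof (cases "l < k")
        case True
        then show ?thesis using lt[of l] lt[of "l - 1"] by simp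
      next
        case False
        then show ?thesis using ge[of l] ge[of "l - 1"] l by simp
      qed
      then have "flag_step (a l) (T l) (F l) (F l)" using s[OF l(1)] by simp
      moreover have "l \<le> m" using l(1) by simp
      ultimately show ?thesis using flag_step_reflD[OF Fs T(1)[OF l(1)] T(2)[OF l(1)]] by blast
    qed
    \<comment> \<open>Outside \<open>{1..m}\<close> both sides are \<open>undefined\<close>, which
      makes the exponent equal to the unit vector as a function.\<close>
    then have "a = (\<lambda>l\<in>{1..m}. if l = k then 1 else 0)"
      using ak a by (auto simp: PiE_def extensional_def fun_eq_iff)
    moreover have "F = (\<lambda>l\<in>{0..m}. if l < k then ?top else ?bot)"
      using lt ge F(1) by (auto simp: PiE_def extensional_def fun_eq_iff)
    ultimately show ?rhs using kI ak(2) by blast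
  next
    assume ?rhs
    then obtain k where k: "k \<in> {1..m}" "isomorphic C V (T k)" "a = (\<lambda>l\<in>{1..m}. if l = k then 1 else 0)"
      and F: "F = (\<lambda>l\<in>{0..m}. if l < k then ?top else ?bot)" by blast
    have Fl: "F l = (if l < k then ?top else ?bot)" if "l \<le> m" for l
      unfolding F using that by simp
    have al: "a l = (if l = k then 1 else 0)" if "l \<in> {1..m}" for l
      unfolding k(3) using that by simp
    have "F l \<in> Subobjects C V" if "l \<in> {0..m}" for l using that Fl[of l] top(1) bot(1) by simp
    moreover have "F \<in> extensional {0..m}" unfolding F by (rule restrict_extensional)
    ultimately have "F \<in> {0..m} \<rightarrow>\<^sub>E Subobjects C V" unfolding PiE_def Pi_def by blast
    moreover have "Idn C V \<in> F 0" using Fl[of 0] k(1) top(2) by simp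
    moreover have "\<exists>r\<in>F m. is_zero_obj C (Src C r)"
    proof (rule bexI)
      show "is_zero_obj C (Src C (Zro C Z V))" using Z HomD(2)[OF zro_hom[OF Z1 V1(1)]] by simp
      show "Zro C Z V \<in> F m" using Fl[of m] k(1) bot(2) by simp
    qed
    moreover have "flag_step (a l) (T l) (F (l - 1)) (F l)" if l: "l \<in> {1..m}" for l
    proof (cases "l = k")
      case True
      then have "F (l - 1) = ?top" "F l = ?bot" "a l = 1" using Fl[of "l - 1"] Fl[of l] al[OF l] l by auto
      then show ?thesis using flag_step_simple_zero[OF Z V T(1)[OF l] T(2)[OF l]] k(2) True by simp
    next
      case False
      \<comment> \<open>Since \<open>l\<close> is positive and differs from \<open>k\<close>, the
        indices \<open>l - 1\<close> and \<open>l\<close> lie on the same side of the jump, and the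
        step is stationary.\<close>
      then have "l - 1 < k \<longleftrightarrow> l < k" "l - 1 \<le> m" "l \<le> m" using l by auto
      then have "F (l - 1) = F l" using Fl by metis
      moreover have "a l = 0" using False al[OF l] by simp
      moreover have "F l \<in> Subobjects C V" "F l \<noteq> {}" using Fl[of l] l top bot by auto
      ultimately show ?thesis using flag_step_refl[OF _ _ T(1)[OF l]] by simp
    qed
    ultimately show "F \<in> Flags C m T a V" using F_iff by blast
  qed
qed

end

section \<open>The quantum polynomial algebra\<close>

lemma free_algebra_simps:
  "carrier (free_algebra L) = {x. finite {w. x w \<noteq> 0} \<and> {w. x w \<noteq> 0} \<subseteq> lists L}"
  "x \<otimes>\<^bsub>free_algebra L\<^esub> y = (\<lambda>w. \<Sum>j\<le>length w. x (take j w) * y (drop j w))"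
  "\<one>\<^bsub>free_algebra L\<^esub> = basis_vec []"
  "\<zero>\<^bsub>free_algebra L\<^esub> = (\<lambda>w. 0)"
  "x \<oplus>\<^bsub>free_algebra L\<^esub> y = (\<lambda>w. x w + y w)"
  "c \<odot>\<^bsub>free_algebra L\<^esub> x = (\<lambda>w. c * x w)"
  by (simp_all add: free_algebra_def)

text \<open>Both sides sum over the ways to cut \<open>w\<close> into three consecutive words. On
  the left the cut is recorded by its two positions \<open>i \<le> j\<close>, on the right by the
  first position and the length \<open>j - i\<close> of the middle word.\<close>

lemma free_algebra_mult_assoc:
  fixes x y z :: "'l list \<Rightarrow> 'k::field"
  shows "(\<Sum>j\<le>length w. (\<Sum>i\<le>length (take j w). x (take i (take j w)) * y (drop i (take j w))) * z (drop j w))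
    = (\<Sum>i\<le>length w. x (take i w) * (\<Sum>j\<le>length (drop i w). y (take j (drop i w)) * z (drop j (drop i w))))"
proof -
  have "(\<Sum>j\<le>length w. (\<Sum>i\<le>length (take j w). x (take i (take j w)) * y (drop i (take j w))) * z (drop j w))
    = (\<Sum>j\<le>length w. \<Sum>i\<le>j. x (take i w) * y (take (j - i) (drop i w)) * z (drop (j - i) (drop i w)))"
    unfolding sum_distrib_right by (intro sum.cong) (auto simp: min_def drop_take)
  also have "\<dots> = (\<Sum>(j,i)\<in>Sigma {..length w} (\<lambda>j. {..j}). x (take i w) * y (take (j - i) (drop i w)) * z (drop (j - i) (drop i w)))"
    by (rule sum.Sigma) auto
  also have "\<dots> = (\<Sum>(i,j)\<in>Sigma {..length w} (\<lambda>i. {..length w - i}). x (take i w) * y (take j (drop i w)) * z (drop j (drop i w)))"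
    by (rule sum.reindex_bij_witness[of _ "\<lambda>(i,j). (i + j, i)" "\<lambda>(j,i). (i, j - i)"]) auto
  also have "\<dots> = (\<Sum>i\<le>length w. \<Sum>j\<le>length w - i. x (take i w) * y (take j (drop i w)) * z (drop j (drop i w)))"
    by (rule sum.Sigma[symmetric]) auto
  finally show ?thesis by (simp add: sum_distrib_left mult.assoc)
qed

lemma ring_free_algebra: "ring (free_algebra L :: ('k::field, 'l list \<Rightarrow> 'k) module)"
proof (rule ringI)
  let ?F = "free_algebra L :: ('k, 'l list \<Rightarrow> 'k) module"
  show "abelian_group ?F"
  proof (rule abelian_groupI)
    fix x y assume "x \<in> carrier ?F" "y \<in> carrier ?F"
    then have "finite ({w. x w \<noteq> 0} \<union> {w. y w \<noteq> 0})" "{w. x w \<noteq> 0} \<union> {w. y w \<noteq> 0} \<subseteq> lists L"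
      by (auto simp: free_algebra_simps)
    moreover have "{w. x w + y w \<noteq> 0} \<subseteq> {w. x w \<noteq> 0} \<union> {w. y w \<noteq> 0}" by auto
    ultimately show "x \<oplus>\<^bsub>?F\<^esub> y \<in> carrier ?F"
      unfolding free_algebra_simps using finite_subset by blast
  next
    fix x assume "x \<in> carrier ?F"
    then show "\<exists>y\<in>carrier ?F. y \<oplus>\<^bsub>?F\<^esub> x = \<zero>\<^bsub>?F\<^esub>"
      by (intro bexI[of _ "\<lambda>w. - x w"]) (auto simp: free_algebra_simps)
  qed (auto simp: free_algebra_simps)
  show "Group.monoid ?F"
  proof (rule monoidI)
    fix x y assume xy: "x \<in> carrier ?F" "y \<in> carrier ?F"
    \<comment> \<open>A nonzero coefficient at \<open>w\<close> requires a cut of \<open>w\<close>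
      into a word in the support of \<open>x\<close> and one in the support of \<open>y\<close>;
      there are finitely many such concatenations.\<close>
    have "{w. (\<Sum>j\<le>length w. x (take j w) * y (drop j w)) \<noteq> 0}
      \<subseteq> (\<lambda>(u, v). u @ v) ` ({w. x w \<noteq> 0} \<times> {w. y w \<noteq> 0})"
    proof
      fix w assume "w \<in> {w. (\<Sum>j\<le>length w. x (take j w) * y (drop j w)) \<noteq> 0}"
      then obtain j where "x (take j w) * y (drop j w) \<noteq> 0" by (auto elim: sum.not_neutral_contains_not_neutral)
      then show "w \<in> (\<lambda>(u, v). u @ v) ` ({w. x w \<noteq> 0} \<times> {w. y w \<noteq> 0})"
        by (intro image_eqI[of _ _ "(take j w, drop j w)"]) auto
    qed
    moreover have "finite ((\<lambda>(u, v). u @ v) ` ({w. x w \<noteq> 0} \<times> {w. y w \<noteq> 0}))"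
      "(\<lambda>(u, v). u @ v) ` ({w. x w \<noteq> 0} \<times> {w. y w \<noteq> 0}) \<subseteq> lists L"
      using xy by (auto simp: free_algebra_simps subset_iff in_lists_conv_set)
    ultimately show "x \<otimes>\<^bsub>?F\<^esub> y \<in> carrier ?F"
      unfolding free_algebra_simps using finite_subset by blast
  next
    fix x y z
    show "x \<otimes>\<^bsub>?F\<^esub> y \<otimes>\<^bsub>?F\<^esub> z = x \<otimes>\<^bsub>?F\<^esub> (y \<otimes>\<^bsub>?F\<^esub> z)"
      unfolding free_algebra_simps using free_algebra_mult_assoc by fast
  next
    fix x :: "'l list \<Rightarrow> 'k"
    have "(\<Sum>j\<le>length w. basis_vec [] (take j w) * x (drop j w)) = x w" for w
    proof -
      have "(\<Sum>j\<le>length w. basis_vec [] (take j w) * x (drop j w)) = (\<Sum>j\<le>length w. if j = 0 then x w else 0)"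
        by (intro sum.cong) (auto simp: basis_vec_def)
      then show ?thesis by simp
    qed
    then show "\<one>\<^bsub>?F\<^esub> \<otimes>\<^bsub>?F\<^esub> x = x" by (simp add: free_algebra_simps)
    have "(\<Sum>j\<le>length w. x (take j w) * basis_vec [] (drop j w)) = x w" for w
    proof -
      have "(\<Sum>j\<le>length w. x (take j w) * basis_vec [] (drop j w)) = (\<Sum>j\<le>length w. if j = length w then x w else 0)"
        by (intro sum.cong) (auto simp: basis_vec_def)
      then show ?thesis by simp
    qed
    then show "x \<otimes>\<^bsub>?F\<^esub> \<one>\<^bsub>?F\<^esub> = x" by (simp add: free_algebra_simps)
  qed (auto simp: free_algebra_simps basis_vec_def)
qed (auto simp: free_algebra_simps sum.distrib algebra_simps)

lemma basis_vec_in_free_algebra: "w \<in> lists L \<Longrightarrow> basis_vec w \<in> carrier (free_algebra L)"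
  by (auto simp: free_algebra_simps basis_vec_def)

lemma quotient_algebra_simps:
  "carrier (quotient_algebra A J) = carrier (A Quot J)"
  "monoid.mult (quotient_algebra A J) = monoid.mult (A Quot J)"
  "one (quotient_algebra A J) = one (A Quot J)"
  "ring.zero (quotient_algebra A J) = ring.zero (A Quot J)"
  "add (quotient_algebra A J) = add (A Quot J)"
  by (simp_all add: quotient_algebra_def)

text \<open>The record \<open>quotient_algebra A J\<close> carries the ring operations of
  \<open>A Quot J\<close> but also a scalar multiplication, so the ring axioms are transported from
  one record to the other.\<close>

lemma ring_quotient_algebra:
  assumes "ideal J A"
  shows "ring (quotient_algebra A J)"
proof -
  interpret Q: ring "A Quot J" by (rule ideal.quotient_is_ring[OF assms])
  show ?thesis
  proof (rule ringI)
    show "abelian_group (quotient_algebra A J)"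
    proof (rule abelian_groupI, unfold quotient_algebra_simps)
      fix x assume "x \<in> carrier (A Quot J)"
      then show "\<exists>y\<in>carrier (A Quot J). y \<oplus>\<^bsub>A Quot J\<^esub> x = \<zero>\<^bsub>A Quot J\<^esub>"
        using Q.l_neg Q.a_inv_closed by blast
    qed (simp_all add: Q.a_assoc, rule Q.a_comm)
    show "Group.monoid (quotient_algebra A J)"
      by (rule monoidI) (simp_all add: quotient_algebra_simps Q.m_assoc)
  qed (simp_all add: quotient_algebra_simps Q.l_distr Q.r_distr)
qed

text \<open>A scalar acts on a coset as a union over its elements. For the scalar 1 each element
  contributes the coset itself, and the union is not empty because a coset contains its
  representative.\<close>

lemma smult_one_quotient_algebra:
  fixes A :: "('k::field, 'a) module"
  assumes "D \<in> carrier (quotient_algebra A J)" "\<And>x. x \<in> carrier A \<Longrightarrow> 1 \<odot>\<^bsub>A\<^esub> x = x" "ideal J A"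
  shows "1 \<odot>\<^bsub>quotient_algebra A J\<^esub> D = D"
proof -
  interpret ideal J A by fact
  obtain a where a: "a \<in> carrier A" "D = J +>\<^bsub>A\<^esub> a"
    using assms(1) by (auto simp: quotient_algebra_simps FactRing_simps)
  have "J +>\<^bsub>A\<^esub> (1 \<odot>\<^bsub>A\<^esub> x) = D" if "x \<in> D" for x
  proof -
    have "x \<in> carrier A" using that a a_r_coset_subset_G a_subset by blast
    then show ?thesis using that a assms(2) a_repr_independence a_subgroup by metis
  qed
  moreover have "D \<noteq> {}" using a a_rcos_self by blast
  ultimately show ?thesis by (auto simp: quotient_algebra_def)
qed

text \<open>\<open>genideal\<close> yields an ideal once its generators lie in the ring, so each
  relator is checked to be supported on the two words \<open>[l, k]\<close> and
  \<open>[k, l]\<close> over \<open>{1..m}\<close>.\<close>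

lemma ideal_P_ideal: "ideal (P_ideal C emb m T) (free_algebra {1..m})"
  unfolding P_ideal_def
proof (rule ring.genideal_ideal[OF ring_free_algebra], clarify)
  fix k l :: nat assume kl: "1 \<le> k" "k < l" "l \<le> m"
  have "{w. basis_vec [l, k] w - c * basis_vec [k, l] w \<noteq> 0} \<subseteq> {[l,k],[k,l]}" for c
    by (rule subsetI, rule ccontr) (simp add: basis_vec_def)
  moreover have "{[l,k],[k,l]} \<subseteq> lists {1..m}" using kl by auto
  ultimately show "(\<lambda>w. basis_vec [l, k] w - emb (euler C (T k) (T l) * euler C (T l) (T k)) * basis_vec [k, l] w)
    \<in> carrier (free_algebra {1..m})"
    unfolding free_algebra_simps using finite_subset[of _ "{[l,k],[k,l]}"] by blast
qed

lemma ring_P_algebra: "ring (P_algebra C emb m T)"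
  unfolding P_algebra_def by (rule ring_quotient_algebra[OF ideal_P_ideal])

lemma smult_one_P_algebra:
  "x \<in> carrier (P_algebra C emb m T) \<Longrightarrow> 1 \<odot>\<^bsub>P_algebra C emb m T\<^esub> x = x"
  unfolding P_algebra_def
  by (rule smult_one_quotient_algebra[OF _ _ ideal_P_ideal]) (simp_all add: free_algebra_simps)

lemma P_gen_closed: "k \<in> {1..m} \<Longrightarrow> P_gen C emb m T k \<in> carrier (P_algebra C emb m T)"
  unfolding P_algebra_def P_gen_def quotient_algebra_simps FactRing_simps
  using basis_vec_in_free_algebra[of "[k]" "{1..m}"] by auto

text \<open>All factors except the one at \<open>k0\<close> are zeroth powers, and distinctness
  makes \<open>k0\<close> occur at most once.\<close>

lemma (in monoid) foldr_pow_single: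
  assumes "distinct xs" "\<And>k. k \<in> set xs \<Longrightarrow> a k = (if k = k0 then 1 else (0::nat))" "g k0 \<in> carrier G"
  shows "foldr (\<lambda>k y. (g k [^] a k) \<otimes> y) xs \<one> = (if k0 \<in> set xs then g k0 else \<one>)"
  using assms(1,2)
proof (induction xs)
  case (Cons x xs)
  then show ?case using assms(3) by (cases "x = k0") auto
qed simp

lemma P_monomial_single:
  assumes "k \<in> {1..m}" "\<And>l. l \<in> {1..m} \<Longrightarrow> a l = (if l = k then 1 else 0)"
  shows "P_monomial C emb m T a = P_gen C emb m T k"
proof -
  interpret ring "P_algebra C emb m T" by (rule ring_P_algebra)
  show ?thesis unfolding P_monomial_def
    using assms by (subst foldr_pow_single[where ?k0.0 = k]) (auto simp: P_gen_closed)
qed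

section \<open>The Hall algebra and its subalgebras\<close>

lemma generated_subalgebra_simps:
  "x \<otimes>\<^bsub>generated_subalgebra A D\<^esub> y = x \<otimes>\<^bsub>A\<^esub> y"
  "x \<oplus>\<^bsub>generated_subalgebra A D\<^esub> y = x \<oplus>\<^bsub>A\<^esub> y"
  "\<one>\<^bsub>generated_subalgebra A D\<^esub> = \<one>\<^bsub>A\<^esub>"
  "c \<odot>\<^bsub>generated_subalgebra A D\<^esub> x = c \<odot>\<^bsub>A\<^esub> x"
  by (simp_all add: generated_subalgebra_def)

lemma carrier_generated_subalgebra_iff:
  "x \<in> carrier (generated_subalgebra A D) \<longleftrightarrow>
    (\<forall>B. subring B A \<longrightarrow> (\<forall>c. \<forall>x\<in>B. c \<odot>\<^bsub>A\<^esub> x \<in> B) \<longrightarrow> D \<subseteq> B \<longrightarrow> x \<in> B)"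
  by (auto simp: generated_subalgebra_def)

lemma generated_subalgebra_minimal:
  assumes "subring B A" "\<And>c x. x \<in> B \<Longrightarrow> c \<odot>\<^bsub>A\<^esub> x \<in> B" "D \<subseteq> B"
  shows "carrier (generated_subalgebra A D) \<subseteq> B"
  using assms by (auto simp: carrier_generated_subalgebra_iff)

lemma generated_subalgebra_generators: "D \<subseteq> carrier (generated_subalgebra A D)"
  by (auto simp: carrier_generated_subalgebra_iff)

lemma subringD:
  assumes "subring B A"
  shows "\<one>\<^bsub>A\<^esub> \<in> B" "x \<in> B \<Longrightarrow> y \<in> B \<Longrightarrow> x \<otimes>\<^bsub>A\<^esub> y \<in> B" "x \<in> B \<Longrightarrow> y \<in> B \<Longrightarrow> x \<oplus>\<^bsub>A\<^esub> y \<in> B"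
proof -
  interpret subring B A by fact
  show "\<one>\<^bsub>A\<^esub> \<in> B" by (rule one_closed)
  show "x \<in> B \<Longrightarrow> y \<in> B \<Longrightarrow> x \<otimes>\<^bsub>A\<^esub> y \<in> B" by (rule m_closed)
  show "x \<in> B \<Longrightarrow> y \<in> B \<Longrightarrow> x \<oplus>\<^bsub>A\<^esub> y \<in> B" using subgroup.m_closed[OF subgroup_axioms] by simp
qed

lemma generated_subalgebra_closed:
  assumes "x \<in> carrier (generated_subalgebra A D)"
  shows "c \<odot>\<^bsub>A\<^esub> x \<in> carrier (generated_subalgebra A D)"
    and "y \<in> carrier (generated_subalgebra A D) \<Longrightarrow> x \<otimes>\<^bsub>A\<^esub> y \<in> carrier (generated_subalgebra A D)"
    and "y \<in> carrier (generated_subalgebra A D) \<Longrightarrow> x \<oplus>\<^bsub>A\<^esub> y \<in> carrier (generated_subalgebra A D)"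
  using assms subringD unfolding carrier_generated_subalgebra_iff by metis+

lemma generated_subalgebra_one: "\<one>\<^bsub>A\<^esub> \<in> carrier (generated_subalgebra A D)"
  using subringD unfolding carrier_generated_subalgebra_iff by metis

lemma alg_homD:
  assumes "h \<in> alg_hom A B"
  shows "x \<in> carrier A \<Longrightarrow> h x \<in> carrier B" "h \<one>\<^bsub>A\<^esub> = \<one>\<^bsub>B\<^esub>"
    "x \<in> carrier A \<Longrightarrow> y \<in> carrier A \<Longrightarrow> h (x \<otimes>\<^bsub>A\<^esub> y) = h x \<otimes>\<^bsub>B\<^esub> h y"
    "x \<in> carrier A \<Longrightarrow> y \<in> carrier A \<Longrightarrow> h (x \<oplus>\<^bsub>A\<^esub> y) = h x \<oplus>\<^bsub>B\<^esub> h y"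
    "x \<in> carrier A \<Longrightarrow> h (c \<odot>\<^bsub>A\<^esub> x) = c \<odot>\<^bsub>B\<^esub> h x"
  using assms by (auto simp: alg_hom_def ring_hom_def)

lemma alg_homI:
  assumes "\<And>x. x \<in> carrier A \<Longrightarrow> h x \<in> carrier B" "h \<one>\<^bsub>A\<^esub> = \<one>\<^bsub>B\<^esub>"
    "\<And>x y. x \<in> carrier A \<Longrightarrow> y \<in> carrier A \<Longrightarrow> h (x \<otimes>\<^bsub>A\<^esub> y) = h x \<otimes>\<^bsub>B\<^esub> h y"
    "\<And>x y. x \<in> carrier A \<Longrightarrow> y \<in> carrier A \<Longrightarrow> h (x \<oplus>\<^bsub>A\<^esub> y) = h x \<oplus>\<^bsub>B\<^esub> h y"
    "\<And>c x. x \<in> carrier A \<Longrightarrow> h (c \<odot>\<^bsub>A\<^esub> x) = c \<odot>\<^bsub>B\<^esub> h x"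
  shows "h \<in> alg_hom A B"
  using assms by (auto simp: alg_hom_def ring_hom_def)

text \<open>The premise \<open>sub\<close> excludes the degenerate case of an empty family of
  subrings, whose intersection would leave the domain on which \<open>h\<close> is
  controlled.\<close>

lemma restrict_alg_hom:
  assumes h: "h \<in> alg_hom A B" and sub: "carrier (generated_subalgebra A D) \<subseteq> carrier A"
  shows "restrict h (carrier (generated_subalgebra A D)) \<in> alg_hom (generated_subalgebra A D) B"
  by (rule alg_homI)
    (use sub in \<open>auto simp: generated_subalgebra_simps generated_subalgebra_closed generated_subalgebra_one
      alg_homD[OF h] subset_iff\<close>)

lemma Hall_algebra_simps:
  "carrier (Hall_algebra C emb) = {x. finite {c. x c \<noteq> 0} \<and> {c. x c \<noteq> 0} \<subseteq> Isoclasses C}"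
  "x \<otimes>\<^bsub>Hall_algebra C emb\<^esub> y = (\<lambda>v. if v \<in> Isoclasses C
      then \<Sum>u | x u \<noteq> 0. \<Sum>w | y w \<noteq> 0. x u * y w * Hall_coeff C emb (rep u) (rep w) (rep v) else 0)"
  "\<one>\<^bsub>Hall_algebra C emb\<^esub> = basis_vec {Z. is_zero_obj C Z}"
  "\<zero>\<^bsub>Hall_algebra C emb\<^esub> = (\<lambda>v. 0)"
  "x \<oplus>\<^bsub>Hall_algebra C emb\<^esub> y = (\<lambda>v. x v + y v)"
  "c \<odot>\<^bsub>Hall_algebra C emb\<^esub> x = (\<lambda>v. c * x v)"
  by (simp_all add: Hall_algebra_def)

text \<open>Closure under scalars supplies the additive part of a subring: zero is 0 times the unit,
  and the negative of \<open>x\<close> is \<open>-1\<close> times \<open>x\<close>.\<close>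

lemma subring_HallI:
  assumes B: "B \<subseteq> carrier (Hall_algebra C emb)" and one: "\<one>\<^bsub>Hall_algebra C emb\<^esub> \<in> B"
    and mult: "\<And>x y. x \<in> B \<Longrightarrow> y \<in> B \<Longrightarrow> x \<otimes>\<^bsub>Hall_algebra C emb\<^esub> y \<in> B"
    and add: "\<And>x y. x \<in> B \<Longrightarrow> y \<in> B \<Longrightarrow> x \<oplus>\<^bsub>Hall_algebra C emb\<^esub> y \<in> B"
    and smult: "\<And>c x. x \<in> B \<Longrightarrow> c \<odot>\<^bsub>Hall_algebra C emb\<^esub> x \<in> B"
  shows "subring B (Hall_algebra C emb)"
proof (intro subring.intro subgroup.intro submonoid.intro)
  have "0 \<odot>\<^bsub>Hall_algebra C emb\<^esub> \<one>\<^bsub>Hall_algebra C emb\<^esub> = \<zero>\<^bsub>Hall_algebra C emb\<^esub>"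
    by (simp add: Hall_algebra_simps)
  then show "\<one>\<^bsub>add_monoid (Hall_algebra C emb)\<^esub> \<in> B" using smult[OF one, of 0] by simp
  fix x assume x: "x \<in> B"
  \<comment> \<open>The inverse is a definite description, so uniqueness is also required; it holds
    because addition is pointwise in a field.\<close>
  have "inv\<^bsub>add_monoid (Hall_algebra C emb)\<^esub> x = ((-1) \<odot>\<^bsub>Hall_algebra C emb\<^esub> x)"
    unfolding m_inv_def
  proof (rule the_equality)
    show "((-1) \<odot>\<^bsub>Hall_algebra C emb\<^esub> x) \<in> carrier (add_monoid (Hall_algebra C emb)) \<and>
      x \<otimes>\<^bsub>add_monoid (Hall_algebra C emb)\<^esub> ((-1) \<odot>\<^bsub>Hall_algebra C emb\<^esub> x) = \<one>\<^bsub>add_monoid (Hall_algebra C emb)\<^esub> \<and>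
      ((-1) \<odot>\<^bsub>Hall_algebra C emb\<^esub> x) \<otimes>\<^bsub>add_monoid (Hall_algebra C emb)\<^esub> x = \<one>\<^bsub>add_monoid (Hall_algebra C emb)\<^esub>"
      using subsetD[OF B smult[OF x, of "-1"]] by (simp add: Hall_algebra_simps)
  next
    fix y assume "y \<in> carrier (add_monoid (Hall_algebra C emb)) \<and>
      x \<otimes>\<^bsub>add_monoid (Hall_algebra C emb)\<^esub> y = \<one>\<^bsub>add_monoid (Hall_algebra C emb)\<^esub> \<and>
      y \<otimes>\<^bsub>add_monoid (Hall_algebra C emb)\<^esub> x = \<one>\<^bsub>add_monoid (Hall_algebra C emb)\<^esub>"
    then have "\<forall>v. y v + x v = 0" by (auto simp: Hall_algebra_simps fun_eq_iff)
    then show "y = ((-1) \<odot>\<^bsub>Hall_algebra C emb\<^esub> x)"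
      by (simp add: Hall_algebra_simps fun_eq_iff eq_neg_iff_add_eq_0)
  qed
  then show "inv\<^bsub>add_monoid (Hall_algebra C emb)\<^esub> x \<in> B" using smult[OF x] by simp
qed (use B one mult add in simp_all)

lemma smult_Hall_closed:
  assumes "x \<in> carrier (Hall_algebra C emb)"
  shows "c \<odot>\<^bsub>Hall_algebra C emb\<^esub> x \<in> carrier (Hall_algebra C emb)"
proof -
  have "{v. c * x v \<noteq> 0} \<subseteq> {v. x v \<noteq> 0}" by auto
  then show ?thesis using assms finite_subset by (auto simp: Hall_algebra_simps)
qed

lemma dual_elt_closed: "V \<in> Obj C \<Longrightarrow> dual_elt C emb f V \<in> carrier (Hall_algebra C emb)"
  unfolding dual_elt_def
  by (rule smult_Hall_closed) (auto simp: Hall_algebra_simps basis_vec_def Isoclasses_def)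

section \<open>Finite support of Hall products and the character of a simple object\<close>

context abelian_category
begin

lemma mult_Hall_closed:
  assumes "finitary C" and x: "x \<in> carrier (Hall_algebra C emb)" and y: "y \<in> carrier (Hall_algebra C emb)"
  shows "x \<otimes>\<^bsub>Hall_algebra C emb\<^esub> y \<in> carrier (Hall_algebra C emb)"
proof -
  let ?M = "\<Union>u\<in>{u. x u \<noteq> 0}. \<Union>w\<in>{w. y w \<noteq> 0}. {v \<in> Isoclasses C. Hall_set C (rep u) (rep w) (rep v) \<noteq> {}}"
  have supp: "finite {u. x u \<noteq> 0}" "finite {w. y w \<noteq> 0}" "{u. x u \<noteq> 0} \<subseteq> Isoclasses C" "{w. y w \<noteq> 0} \<subseteq> Isoclasses C"
    using x y by (auto simp: Hall_algebra_simps)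
  have "finite ?M"
  proof (intro finite_UN_I supp(1,2) finite_Hall_products)
    fix u w assume "u \<in> {u. x u \<noteq> 0}" "w \<in> {w. y w \<noteq> 0}"
    then have "rep u \<in> Obj C" "rep w \<in> Obj C" using rep_isoclass(1) supp(3,4) by blast+
    then show "finite (Ext C 1 (rep u) (rep w))" using assms(1) unfolding finitary_def by blast
  qed
  moreover have "{v. (x \<otimes>\<^bsub>Hall_algebra C emb\<^esub> y) v \<noteq> 0} \<subseteq> ?M"
  proof
    fix v assume "v \<in> {v. (x \<otimes>\<^bsub>Hall_algebra C emb\<^esub> y) v \<noteq> 0}"
    then have v: "v \<in> Isoclasses C"
      and "(\<Sum>u | x u \<noteq> 0. \<Sum>w | y w \<noteq> 0. x u * y w * Hall_coeff C emb (rep u) (rep w) (rep v)) \<noteq> 0"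
      by (auto simp: Hall_algebra_simps split: if_splits)
    then obtain u where u: "x u \<noteq> 0"
      "(\<Sum>w | y w \<noteq> 0. x u * y w * Hall_coeff C emb (rep u) (rep w) (rep v)) \<noteq> 0"
      by (metis (mono_tags, lifting) mem_Collect_eq sum.not_neutral_contains_not_neutral)
    then obtain w where w: "y w \<noteq> 0" "x u * y w * Hall_coeff C emb (rep u) (rep w) (rep v) \<noteq> 0"
      by (metis (mono_tags, lifting) mem_Collect_eq sum.not_neutral_contains_not_neutral)
    \<comment> \<open>An empty Hall set has cardinality 0 and would make the coefficient
      vanish.\<close>
    then have "Hall_set C (rep u) (rep w) (rep v) \<noteq> {}" by (auto simp: Hall_coeff_def)
    then show "v \<in> ?M" using u w v by blast
  qed
  ultimately have "finite {v. (x \<otimes>\<^bsub>Hall_algebra C emb\<^esub> y) v \<noteq> 0}"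
    "{v. (x \<otimes>\<^bsub>Hall_algebra C emb\<^esub> y) v \<noteq> 0} \<subseteq> Isoclasses C"
    using finite_subset by blast+
  then show ?thesis by (simp add: Hall_algebra_simps(1))
qed

text \<open>The zero objects form exactly one isomorphism class, so the unit is a basis vector of
  the Hall algebra.\<close>

lemma one_Hall_closed: "\<one>\<^bsub>Hall_algebra C emb\<^esub> \<in> carrier (Hall_algebra C emb)"
proof -
  obtain Z where "is_zero_obj C Z" using zero_obj by blast
  then have "{Z. is_zero_obj C Z} \<in> Isoclasses C"
    using zero_obj_isoclass is_zero_obj_iff unfolding Isoclasses_def by blast
  then show ?thesis by (auto simp: Hall_algebra_simps basis_vec_def)
qed

lemma add_Hall_closed:
  assumes "x \<in> carrier (Hall_algebra C emb)" "y \<in> carrier (Hall_algebra C emb)"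
  shows "x \<oplus>\<^bsub>Hall_algebra C emb\<^esub> y \<in> carrier (Hall_algebra C emb)"
proof -
  have "{v. x v + y v \<noteq> 0} \<subseteq> {v. x v \<noteq> 0} \<union> {v. y v \<noteq> 0}" by auto
  moreover have "finite ({v. x v \<noteq> 0} \<union> {v. y v \<noteq> 0})" "{v. x v \<noteq> 0} \<union> {v. y v \<noteq> 0} \<subseteq> Isoclasses C"
    using assms by (auto simp: Hall_algebra_simps)
  ultimately show ?thesis unfolding Hall_algebra_simps using finite_subset by blast
qed

lemma subring_carrier_Hall: "finitary C \<Longrightarrow> subring (carrier (Hall_algebra C emb)) (Hall_algebra C emb)"
  by (rule subring_HallI)
    (auto intro: mult_Hall_closed one_Hall_closed add_Hall_closed smult_Hall_closed)

lemma X_char_simple: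
  fixes emb :: "real \<Rightarrow> 'k::field_char_0"
  assumes C: "finitary C" "hereditary C" and emb: "euler_embedding C emb"
    and V: "is_simple C V" and T: "\<And>k. k \<in> {1..m} \<Longrightarrow> is_simple C (T k)"
  shows "X_char C emb m T V =
    (\<Oplus>\<^bsub>P_algebra C emb m T\<^esub>k\<in>{k\<in>{1..m}. isomorphic C V (T k)}. P_gen C emb m T k)"
proof -
  interpret P: ring "P_algebra C emb m T" by (rule ring_P_algebra)
  obtain Z where Z: "is_zero_obj C Z" using zero_obj by blast
  have T': "T k \<in> Obj C" "\<not> is_zero_obj C (T k)" if "k \<in> {1..m}" for k
    using T[OF that] by (auto simp: is_simple_def)
  define K where "K = {k\<in>{1..m}. isomorphic C V (T k)}"
  define e :: "nat \<Rightarrow> nat \<Rightarrow> nat" where "e = (\<lambda>k. \<lambda>l\<in>{1..m}. if l = k then 1 else 0)"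
  define c where "c = (\<lambda>a. emb (\<Prod>l\<in>{1..m}. \<Prod>k\<in>{1..<l}.
      (euler C (T k) (T l) / euler C (T l) (T k)) powr (real (a k * a l) / 2)) * of_nat (card (Flags C m T a V)))"
  let ?F = "\<lambda>k. \<lambda>l\<in>{0..m}. if l < k then subobject C (Idn C V) else subobject C (Zro C Z V)"
  have iff: "F \<in> Flags C m T a V \<longleftrightarrow> (\<exists>k\<in>K. a = e k \<and> F = ?F k)" if "a \<in> {1..m} \<rightarrow>\<^sub>E UNIV" for a F
    using Flags_simple_iff[OF V Z that, of T F] T' by (auto simp: K_def e_def)
  have eE: "e k \<in> {1..m} \<rightarrow>\<^sub>E UNIV" for k by (simp add: e_def)
  \<comment> \<open>Injectivity is used twice: it shows that an exponent \<open>e k\<close> admits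
    only the flag jumping at \<open>k\<close>, and it reindexes the sum over exponents as a sum over
    \<open>K\<close>.\<close>
  have e_inj: "inj_on e K"
  proof (rule inj_onI)
    fix k l assume k: "k \<in> K" and kl: "e k = e l"
    have km: "k \<in> {1..m}" using k by (simp add: K_def)
    then have "e k k = 1" by (simp add: e_def)
    then have "e l k = 1" by (simp only: kl)
    show "k = l"
    proof (rule ccontr)
      assume "k \<noteq> l"
      then have "e l k = 0" using km by (simp add: e_def)
      then show False using \<open>e l k = 1\<close> by simp
    qed
  qed
  have fl: "Flags C m T (e k) V = {?F k}" if "k \<in> K" for k
  proof -
    have "F \<in> Flags C m T (e k) V \<longleftrightarrow> F \<in> {?F k}" for F
    proof -
      have "F \<in> Flags C m T (e k) V \<longleftrightarrow> (\<exists>l\<in>K. k = l \<and> F = ?F l)"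
        unfolding iff[OF eE] using inj_onD[OF e_inj _ that] by metis
      then show ?thesis using that by blast
    qed
    then show ?thesis by blast
  qed
  have supp: "{a \<in> {1..m} \<rightarrow>\<^sub>E UNIV. Flags C m T a V \<noteq> {}} = e ` K"
  proof (intro equalityI subsetI)
    fix a assume "a \<in> {a \<in> {1..m} \<rightarrow>\<^sub>E UNIV. Flags C m T a V \<noteq> {}}"
    then obtain F where "a \<in> {1..m} \<rightarrow>\<^sub>E UNIV" "F \<in> Flags C m T a V" by blast
    then show "a \<in> e ` K" using iff by blast
  next
    fix a assume "a \<in> e ` K"
    then show "a \<in> {a \<in> {1..m} \<rightarrow>\<^sub>E UNIV. Flags C m T a V \<noteq> {}}" using fl eE by force
  qed
  have emb1: "emb 1 = 1"
    using emb by (auto simp: euler_embedding_def ring_hom_def ring_of_type_algebra_def)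
  have c1: "c (e k) = 1" if k: "k \<in> K" for k
  proof -
    have "(euler C (T i) (T l) / euler C (T l) (T i)) powr (real (e k i * e k l) / 2) = 1"
      if "l \<in> {1..m}" "i \<in> {1..<l}" for i l
    proof -
      \<comment> \<open>As \<open>i < l\<close>, at most one of the two coordinates of the unit
        vector is nonzero. The exponent is therefore 0, and a nonzero base is needed for the power
        to be 1.\<close>
      have "e k i * e k l = 0" using that by (simp add: e_def)
      moreover have "euler C (T i) (T l) / euler C (T l) (T i) \<noteq> 0"
        using euler_pos[OF C T'(1) T'(1), of i l] euler_pos[OF C T'(1) T'(1), of l i] that by simp
      ultimately show ?thesis by auto
    qed
    then have "(\<Prod>l\<in>{1..m}. \<Prod>i\<in>{1..<l}.
      (euler C (T i) (T l) / euler C (T l) (T i)) powr (real (e k i * e k l) / 2)) = 1"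
      by (intro prod.neutral ballI)
    then show ?thesis by (simp add: c_def fl[OF k] emb1)
  qed
  have summand: "c (e k) \<odot>\<^bsub>P_algebra C emb m T\<^esub> P_monomial C emb m T (e k) = P_gen C emb m T k" if "k \<in> K" for k
  proof -
    have k: "k \<in> {1..m}" using that by (simp add: K_def)
    then have "P_monomial C emb m T (e k) = P_gen C emb m T k"
      by (rule P_monomial_single) (simp add: e_def)
    then show ?thesis using c1[OF that] smult_one_P_algebra[OF P_gen_closed[OF k]] by simp
  qed
  have gen: "P_gen C emb m T k \<in> carrier (P_algebra C emb m T)" if "k \<in> K" for k
    using that by (intro P_gen_closed) (simp add: K_def)
  have "X_char C emb m T V = (\<Oplus>\<^bsub>P_algebra C emb m T\<^esub>a\<in>e ` K. c a \<odot>\<^bsub>P_algebra C emb m T\<^esub> P_monomial C emb m T a)"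
    unfolding X_char_def supp c_def by (rule refl)
  also have "\<dots> = (\<Oplus>\<^bsub>P_algebra C emb m T\<^esub>k\<in>K. c (e k) \<odot>\<^bsub>P_algebra C emb m T\<^esub> P_monomial C emb m T (e k))"
    using summand gen by (intro P.finsum_reindex e_inj) auto
  also have "\<dots> = (\<Oplus>\<^bsub>P_algebra C emb m T\<^esub>k\<in>K. P_gen C emb m T k)"
    using summand gen by (intro P.finsum_cong') auto
  finally show ?thesis by (simp add: K_def)
qed

end

section \<open>Existence and uniqueness of the homomorphism on the subalgebra\<close>

theorem corollary2p2:
  fixes C :: "('o, 'm) precat"
    and emb :: "real \<Rightarrow> 'k::field_char_0"
    and f :: "('o set \<Rightarrow>\<^sub>0 int) set \<Rightarrow> 'k"
    and S :: "'i \<Rightarrow> 'o" and I :: "'i set"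
    and m :: nat and ii :: "nat \<Rightarrow> 'i"
    and \<Psi> :: "('o set \<Rightarrow> 'k) \<Rightarrow> (nat list \<Rightarrow> 'k) set"
  defines "T \<equiv> \<lambda>k. S (ii k)"
  defines "H \<equiv> Hall_algebra C emb"
    and "U \<equiv> U_plus C emb f S I"
    and "P \<equiv> P_algebra C emb m T"
  assumes "abelian_category C" and "finitary C" and "hereditary C" and "cofinitary C"
    and "euler_embedding C emb"
    and "euler_character C emb f"
    and "\<And>j. j \<in> I \<Longrightarrow> is_simple C (S j)"
    and "\<And>j l. j \<in> I \<Longrightarrow> l \<in> I \<Longrightarrow> j \<noteq> l \<Longrightarrow> \<not> isomorphic C (S j) (S l)"
    and "\<And>j. j \<in> I \<Longrightarrow> Ext_vanishes C 1 (S j) (S j)"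
    and "\<And>k. k \<in> {1..m} \<Longrightarrow> ii k \<in> I"
    and "\<Psi> \<in> alg_hom H P"
    and "\<And>V. V \<in> Obj C \<Longrightarrow> \<Psi> (dual_elt C emb f V) = X_char C emb m T V"
  shows "{\<phi> \<in> alg_hom U P \<inter> extensional (carrier U).
      \<forall>j\<in>I. \<phi> (dual_elt C emb f (S j)) = (\<Oplus>\<^bsub>P\<^esub>k\<in>{k\<in>{1..m}. ii k = j}. P_gen C emb m T k)}
    = {restrict \<Psi> (carrier U)}"
proof -
  interpret abelian_category C by fact
  note simple = assms(11) and noniso = assms(12) and iiI = assms(14) and \<Psi> = assms(15)
  define D where "D = (\<lambda>j. dual_elt C emb f (S j)) ` I"
  have U: "U = generated_subalgebra H D" by (simp add: U_def U_plus_def H_def D_def)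
  have D: "D \<subseteq> carrier H"
    unfolding D_def H_def
  proof (rule image_subsetI)
    fix j assume "j \<in> I"
    then have "S j \<in> Obj C" using simple by (simp add: is_simple_def)
    then show "dual_elt C emb f (S j) \<in> carrier (Hall_algebra C emb)" by (rule dual_elt_closed)
  qed
  \<comment> \<open>The carrier of \<open>H\<close> is itself one of the scalar-closed subrings
    whose intersection defines \<open>U\<close>.\<close>
  have UH: "carrier U \<subseteq> carrier H"
    unfolding U
    by (rule generated_subalgebra_minimal[OF _ _ D])
      (auto simp: H_def intro: subring_carrier_Hall[OF \<open>finitary C\<close>] smult_Hall_closed)
  have gen: "\<Psi> (dual_elt C emb f (S j)) = (\<Oplus>\<^bsub>P\<^esub>k\<in>{k\<in>{1..m}. ii k = j}. P_gen C emb m T k)"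
    and dU: "dual_elt C emb f (S j) \<in> carrier U" if j: "j \<in> I" for j
  proof -
    \<comment> \<open>Objects \<open>S j\<close> with distinct indices are not isomorphic, so the
      sum over positions with \<open>T k\<close> isomorphic to \<open>S j\<close> becomes the sum
      over positions with index \<open>j\<close>.\<close>
    have "{k\<in>{1..m}. isomorphic C (S j) (T k)} = {k\<in>{1..m}. ii k = j}"
    proof (rule Collect_cong, rule conj_cong[OF refl])
      fix k assume "k \<in> {1..m}"
      then show "isomorphic C (S j) (T k) \<longleftrightarrow> ii k = j"
        using noniso[OF j iiI, of k] isomorphic_refl[of "S j"] simple[OF j]
        unfolding T_def is_simple_def by metis
    qed
    moreover have "is_simple C (T k)" if "k \<in> {1..m}" for k using simple[OF iiI[OF that]] by (simp add: T_def)
    ultimately show "\<Psi> (dual_elt C emb f (S j)) = (\<Oplus>\<^bsub>P\<^esub>k\<in>{k\<in>{1..m}. ii k = j}. P_gen C emb m T k)"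
      using X_char_simple[OF assms(6,7,9) simple[OF j], of m T] assms(16)[of "S j"] simple[OF j]
      by (simp add: P_def is_simple_def)
    show "dual_elt C emb f (S j) \<in> carrier U"
      unfolding U by (rule subsetD[OF generated_subalgebra_generators]) (simp add: D_def j)
  qed
  have hom: "restrict \<Psi> (carrier U) \<in> alg_hom U P"
    using restrict_alg_hom[OF \<Psi>] UH unfolding U by blast
  have unique: "\<phi> = restrict \<Psi> (carrier U)"
    if \<phi>: "\<phi> \<in> alg_hom U P" "\<phi> \<in> extensional (carrier U)"
      and gens: "\<forall>j\<in>I. \<phi> (dual_elt C emb f (S j)) = (\<Oplus>\<^bsub>P\<^esub>k\<in>{k\<in>{1..m}. ii k = j}. P_gen C emb m T k)" for \<phi>
  proof -
    \<comment> \<open>The equaliser of \<open>\<phi>\<close> and \<open>\<Psi>\<close> is a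
      scalar-closed subring of \<open>H\<close> containing the generators, so minimality of
      \<open>U\<close> forces it to be all of \<open>U\<close>.\<close>
    let ?B = "{x \<in> carrier U. \<phi> x = \<Psi> x}"
    have hom: "\<phi> \<one>\<^bsub>H\<^esub> = \<Psi> \<one>\<^bsub>H\<^esub>"
      "\<And>x y. x \<in> ?B \<Longrightarrow> y \<in> ?B \<Longrightarrow> \<phi> (x \<otimes>\<^bsub>H\<^esub> y) = \<Psi> (x \<otimes>\<^bsub>H\<^esub> y)"
      "\<And>x y. x \<in> ?B \<Longrightarrow> y \<in> ?B \<Longrightarrow> \<phi> (x \<oplus>\<^bsub>H\<^esub> y) = \<Psi> (x \<oplus>\<^bsub>H\<^esub> y)"
      "\<And>c x. x \<in> ?B \<Longrightarrow> \<phi> (c \<odot>\<^bsub>H\<^esub> x) = \<Psi> (c \<odot>\<^bsub>H\<^esub> x)"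
      using alg_homD[OF \<phi>(1)] alg_homD[OF \<Psi>] UH
      by (auto simp: U generated_subalgebra_simps subset_iff)
    have closed: "\<one>\<^bsub>H\<^esub> \<in> carrier U"
      "\<And>x y. x \<in> carrier U \<Longrightarrow> y \<in> carrier U \<Longrightarrow> x \<otimes>\<^bsub>H\<^esub> y \<in> carrier U"
      "\<And>x y. x \<in> carrier U \<Longrightarrow> y \<in> carrier U \<Longrightarrow> x \<oplus>\<^bsub>H\<^esub> y \<in> carrier U"
      "\<And>c x. x \<in> carrier U \<Longrightarrow> c \<odot>\<^bsub>H\<^esub> x \<in> carrier U"
      unfolding U by (rule generated_subalgebra_one generated_subalgebra_closed; assumption)+
    have smult: "c \<odot>\<^bsub>H\<^esub> x \<in> ?B" if "x \<in> ?B" for c x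
      using hom(4)[OF that] closed(4) that by blast
    have "subring ?B H"
      unfolding H_def
    proof (rule subring_HallI, unfold H_def[symmetric])
      show "?B \<subseteq> carrier H" using UH by blast
      show "\<one>\<^bsub>H\<^esub> \<in> ?B" using hom(1) closed(1) by blast
      show "x \<otimes>\<^bsub>H\<^esub> y \<in> ?B" if "x \<in> ?B" "y \<in> ?B" for x y
        using hom(2)[OF that] closed(2) that by blast
      show "x \<oplus>\<^bsub>H\<^esub> y \<in> ?B" if "x \<in> ?B" "y \<in> ?B" for x y
        using hom(3)[OF that] closed(3) that by blast
    qed (rule smult)
    moreover have "D \<subseteq> ?B" unfolding D_def using gens gen dU by (intro image_subsetI) simp
    ultimately have "carrier U \<subseteq> ?B"
      using generated_subalgebra_minimal[of ?B H D, OF _ smult] unfolding U[symmetric] by simp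
    then have eq: "\<phi> x = \<Psi> x" if "x \<in> carrier U" for x using that by blast
    \<comment> \<open>Agreement on \<open>carrier U\<close> suffices for equality of functions
      because both are \<open>undefined\<close> elsewhere; this is why the solution set is a
      singleton.\<close>
    show ?thesis
      by (rule extensionalityI[OF \<phi>(2) restrict_extensional]) (simp add: eq)
  qed
  have "restrict \<Psi> (carrier U) (dual_elt C emb f (S j)) = (\<Oplus>\<^bsub>P\<^esub>k\<in>{k\<in>{1..m}. ii k = j}. P_gen C emb m T k)"
    if "j \<in> I" for j
    using gen[OF that] dU[OF that] by simp
  with hom unique show ?thesis by (intro equalityI subsetI) (blast intro: restrict_extensional)+
qed

end
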